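(* For every prime $l$ and every integer $n\ge1$, \[ (k_n)_l\equiv 1\pmod{2^n}, \] where $(k_n)_l=\left|(RE_n^+/A_n)_l\right|$ is the order of the $l$-primary part of $RE_n^+/A_n$.
   Context: $X_j=2\cos(2\pi/2^{j+2})$ for $j\ge0$, $\mathbb{B}_j=\mathbb{Q}(X_j)$ with ring of integers $\mathbb{Z}[X_j]$, class number $h_j$, $G_j=\mathrm{Gal}(\mathbb{B}_j/\mathbb{Q})$ cyclic of order $2^j$ generated by $\sigma$, $E_j$ the unit group. $N_{n/n-1}:E_n\to E_{n-1}$, $x\mapsto x\sigma^{2^{n-1}}(x)$; $RE_n^+=\ker N_{n/n-1}$; $C_n=\langle -1,1+X_n\rangle_{\mathbb{Z}[G_n]}$ the circular units; $A_n=RE_n^+\cap C_n$. The group $RE_n^+/A_n$ is finite, of order $k_n=h_n/h_{n-1}$. The $l$-primary part $(RE_n^+/A_n)_l$ is the subgroup of elements of $l$-power order. *)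

theory Defs
  imports Complex_Main
    "HOL-Algebra.Algebraic_Closure_Type"
    "HOL-Algebra.Generated_Fields"
    "HOL-Algebra.Bij"
    "HOL-Algebra.Multiplicative_Group"
    "HOL-Number_Theory.Cong"
begin

definition gen_X :: "nat \<Rightarrow> real" where
  "gen_X j = 2 * cos (2 * pi / 2 ^ (j + 2))"

definition field_B :: "nat \<Rightarrow> real ring" where
  "field_B j = (ring_of_type_algebra :: real ring)
     \<lparr>carrier := generate_field ring_of_type_algebra (insert (gen_X j) \<rat>)\<rparr>"

definition ring_of_integers :: "('a :: field) ring \<Rightarrow> 'a ring" where
  "ring_of_integers K = K\<lparr>carrier := {x \<in> carrier K. algebraic_int x}\<rparr>"

definition units_E :: "nat \<Rightarrow> real monoid" where
  "units_E j = units_of (ring_of_integers (field_B j))"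

definition gal_group :: "'a ring \<Rightarrow> 'a set \<Rightarrow> ('a \<Rightarrow> 'a) monoid" where
  "gal_group L K = (BijGroup (carrier L))
     \<lparr>carrier := {\<tau> \<in> ring_hom L L \<inter> Bij (carrier L). \<forall>x\<in>K. \<tau> x = x}\<rparr>"

definition gal_G :: "nat \<Rightarrow> (real \<Rightarrow> real) monoid" where
  "gal_G j = gal_group (field_B j) \<rat>"

text \<open>In what follows \<open>\<sigma>\<close> stands for a generator of the cyclic group \<open>gal_G n\<close>.\<close>

definition relnorm :: "(real \<Rightarrow> real) \<Rightarrow> nat \<Rightarrow> real \<Rightarrow> real" where
  "relnorm \<sigma> n x = x * (\<sigma> [^]\<^bsub>gal_G n\<^esub> ((2::nat) ^ (n - 1))) x"

definition RE_plus :: "(real \<Rightarrow> real) \<Rightarrow> nat \<Rightarrow> real set" where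
  "RE_plus \<sigma> n = kernel (units_E n) (units_E (n - 1)) (relnorm \<sigma> n)"

text \<open>The \<open>\<int>[gal_G n]\<close>-submodule of the multiplicatively written module \<open>units_E n\<close> generated by \<open>S\<close>
  is the subgroup generated by the Galois conjugates of the elements of \<open>S\<close>.\<close>

definition galois_span :: "nat \<Rightarrow> real set \<Rightarrow> real set" where
  "galois_span n S = generate (units_E n) {\<tau> u | \<tau> u. \<tau> \<in> carrier (gal_G n) \<and> u \<in> S}"

definition circ_C :: "nat \<Rightarrow> real set" where
  "circ_C n = galois_span n {- 1, 1 + gen_X n}"

definition circ_A :: "(real \<Rightarrow> real) \<Rightarrow> nat \<Rightarrow> real set" where
  "circ_A \<sigma> n = RE_plus \<sigma> n \<inter> circ_C n"

definition RE_mod_A :: "(real \<Rightarrow> real) \<Rightarrow> nat \<Rightarrow> real set monoid" where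
  "RE_mod_A \<sigma> n = (units_E n)\<lparr>carrier := RE_plus \<sigma> n\<rparr> Mod circ_A \<sigma> n"

text \<open>\<^const>\<open>group.ord\<close> is 0 on elements of infinite order, so these are excluded.\<close>

definition primary_part :: "nat \<Rightarrow> ('a, 'b) monoid_scheme \<Rightarrow> 'a set" where
  "primary_part l H = {x \<in> carrier H. \<exists>k. group.ord H x = l ^ k}"

end

theory Submission
  imports Defs "Jordan_Normal_Form.Char_Poly" "HOL-Library.Z2"
begin

text \<open>
  By definition of \<open>RE_n^+\<close>, the automorphism \<open>s = \<sigma>^(2^(n-1))\<close> acts on it as inversion.
  For odd \<open>l\<close> inversion fixes no nontrivial element of an \<open>l\<close>-group, so \<open>\<sigma>\<close> permutes the
  nontrivial elements of the \<open>l\<close>-primary part in orbits of length exactly \<open>2^n\<close>. This part is finite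
  because every torsion class of units modulo circular units has a representative all of whose
  conjugates are bounded by \<open>3^(2^n)\<close>.

  For \<open>l = 2\<close> the primary part is trivial, by Weber's signature argument: \<open>1 + X_n\<close> has norm \<open>-1\<close>, so its
  vector of signs is a unit of the group ring of \<open>G_n\<close> over the field with two elements. Hence a totally
  positive circular unit is the square of a circular unit, and a unit whose square is circular is
  itself circular.

  Everything uses only the tower \<open>B_0 \<subseteq> B_1 \<subseteq> \<dots>\<close> with \<open>X_(j+1)^2 = 2 + X_j\<close>. If \<open>s\<close> fixed \<open>X_n\<close>, then
  \<open>RE_n^+\<close> would be \<open>{1, -1}\<close> and there is nothing to prove; otherwise \<open>\<sigma>^(2^j)\<close> maps \<open>X_(j+1)\<close> to its
  negative for every \<open>j < n\<close>.
\<close>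

section \<open>Sums and products of algebraic integers\<close>

text \<open>The generators form a family rather than a set, because monomials
  \<open>x ^ i * y ^ j\<close> with different exponents may coincide.\<close>

definition int_span :: "('i \<Rightarrow> 'a :: comm_ring_1) \<Rightarrow> 'i set \<Rightarrow> 'a set" where
  "int_span v I = range (\<lambda>c. \<Sum>i\<in>I. of_int (c i) * v i)"

lemma int_spanI: "x = (\<Sum>i\<in>I. of_int (c i) * v i) \<Longrightarrow> x \<in> int_span v I"
  unfolding int_span_def by blast

lemma int_span_base:
  assumes "finite I" "i \<in> I"
  shows "v i \<in> int_span v I"
proof -
  have "v i = (\<Sum>j\<in>I. of_int (if j = i then 1 else 0) * v j)"
    using assms by (simp add: if_distrib[of of_int] if_distrib[of "\<lambda>x. x * _"] cong: if_cong)
  then show ?thesis by (rule int_spanI)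
qed

lemma int_span_add:
  assumes "x \<in> int_span v I" "y \<in> int_span v I"
  shows "x + y \<in> int_span v I"
proof -
  obtain c d where "x = (\<Sum>i\<in>I. of_int (c i) * v i)" "y = (\<Sum>i\<in>I. of_int (d i) * v i)"
    using assms unfolding int_span_def by blast
  then have "x + y = (\<Sum>i\<in>I. of_int (c i + d i) * v i)"
    by (simp add: sum.distrib algebra_simps)
  then show ?thesis by (rule int_spanI)
qed

lemma int_span_of_int_mult:
  assumes "x \<in> int_span v I"
  shows "of_int k * x \<in> int_span v I"
proof -
  obtain c where "x = (\<Sum>i\<in>I. of_int (c i) * v i)"
    using assms unfolding int_span_def by blast
  then have "of_int k * x = (\<Sum>i\<in>I. of_int (k * c i) * v i)"
    by (simp add: sum_distrib_left mult.assoc)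
  then show ?thesis by (rule int_spanI)
qed

lemma int_span_0: "0 \<in> int_span v I"
  unfolding int_span_def by (rule range_eqI[of _ _ "\<lambda>_. 0"]) simp

lemma int_span_sum:
  "(\<And>k. k \<in> K \<Longrightarrow> f k \<in> int_span v I) \<Longrightarrow> (\<Sum>k\<in>K. f k) \<in> int_span v I"
  by (induction K rule: infinite_finite_induct) (auto intro: int_span_add int_span_0)

text \<open>By linearity, stability need only be checked on the generators. This allows two
  multiplications to be applied one after the other.\<close>

lemma int_span_mult:
  assumes "\<And>i. i \<in> I \<Longrightarrow> x * v i \<in> int_span v I" and "y \<in> int_span v I"
  shows "x * y \<in> int_span v I"
proof -
  obtain c where y: "y = (\<Sum>i\<in>I. of_int (c i) * v i)"
    using assms(2) unfolding int_span_def by blast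
  have "x * y = (\<Sum>i\<in>I. of_int (c i) * (x * v i))"
    by (simp add: y sum_distrib_left algebra_simps)
  then show ?thesis
    using assms(1) by (auto intro!: int_span_sum int_span_of_int_mult)
qed

text \<open>An element that maps a nonzero finitely generated \<open>\<int>\<close>-module into itself is an
  eigenvalue of an integer matrix, hence a root of its characteristic polynomial.\<close>

lemma algebraic_int_if_stable_span:
  fixes z :: "'a :: field"
  assumes fin: "finite I" and nz: "\<exists>i\<in>I. v i \<noteq> 0"
    and stable: "\<And>i. i \<in> I \<Longrightarrow> z * v i \<in> int_span v I"
  shows "algebraic_int z"
proof -
  have "\<forall>i\<in>I. \<exists>c. z * v i = (\<Sum>j\<in>I. of_int (c j) * v j)"
    using stable unfolding int_span_def by blast
  then obtain A :: "_ \<Rightarrow> _ \<Rightarrow> int" where A: "\<And>i. i \<in> I \<Longrightarrow> z * v i = (\<Sum>j\<in>I. of_int (A i j) * v j)"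
    by metis
  obtain h where h: "bij_betw h {0..<card I} I"
    using ex_bij_betw_nat_finite[OF fin] by blast
  define m where "m = card I"
  define B :: "int mat" where "B = mat m m (\<lambda>(i, j). A (h i) (h j))"
  define w where "w = vec m (\<lambda>i. v (h i))"
  let ?B = "map_mat of_int B :: 'a mat"
  have B: "B \<in> carrier_mat m m" and oB: "?B \<in> carrier_mat m m"
    by (auto simp: B_def)
  have hI: "h i \<in> I" if "i < m" for i
    using h that by (auto simp: m_def bij_betw_def)
  obtain i0 where "i0 < m" "v (h i0) \<noteq> 0"
    using nz h unfolding bij_betw_def m_def by force
  then have "w \<noteq> 0\<^sub>v m"
    unfolding w_def by (metis index_vec index_zero_vec(1))
  moreover have "?B *\<^sub>v w = z \<cdot>\<^sub>v w"
  proof (rule eq_vecI)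
    fix i assume "i < dim_vec (z \<cdot>\<^sub>v w)"
    then have i: "i < m" by (simp add: w_def)
    have "(?B *\<^sub>v w) $ i = (\<Sum>j\<in>{0..<m}. of_int (A (h i) (h j)) * v (h j))"
      using i by (simp add: B_def w_def scalar_prod_def)
    also have "\<dots> = (\<Sum>j\<in>I. of_int (A (h i) j) * v j)"
      using h unfolding m_def by (rule sum.reindex_bij_betw)
    also have "\<dots> = (z \<cdot>\<^sub>v w) $ i"
      using A[OF hI[OF i]] i by (simp add: w_def)
    finally show "(?B *\<^sub>v w) $ i = (z \<cdot>\<^sub>v w) $ i" .
  qed (simp add: B_def w_def)
  ultimately have "eigenvalue ?B z"
    unfolding eigenvalue_def eigenvector_def using oB by (intro exI[of _ w]) (auto simp: w_def B_def)
  then have "poly (char_poly ?B) z = 0"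
    using eigenvalue_root_char_poly[OF oB] by simp
  moreover have "lead_coeff (char_poly ?B) = 1"
    using degree_monic_char_poly[OF oB] by simp
  moreover have "coeff (char_poly ?B) i \<in> \<int>" for i
    by (simp add: of_int_hom.char_poly_hom[OF B] coeff_map_poly)
  ultimately show ?thesis
    by (intro algebraic_int.intros[of "char_poly ?B"]) auto
qed

text \<open>The monic integral equation is solved for its top power. Positivity of \<open>m\<close>
  puts \<open>x ^ 0 = 1\<close> among the lower powers.\<close>

lemma algebraic_int_power_reduction:
  fixes x :: "'a :: field"
  assumes "algebraic_int x"
  obtains c :: "nat \<Rightarrow> int" and m where "m > 0" "x ^ m = (\<Sum>k<m. of_int (c k) * x ^ k)"
proof -
  from assms obtain p where p: "lead_coeff p = 1" "\<And>i. coeff p i \<in> \<int>" "poly p x = 0"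
    by (auto elim: algebraic_int.cases)
  define m where "m = degree p"
  have "\<forall>i. \<exists>k. coeff p i = of_int k"
    using p(2) by (auto elim: Ints_cases)
  then obtain c where c: "\<And>i. coeff p i = of_int (c i)" by metis
  have "0 = (\<Sum>i\<le>m. coeff p i * x ^ i)"
    using p(3) by (simp add: poly_altdef m_def)
  also have "\<dots> = (\<Sum>i<m. of_int (c i) * x ^ i) + x ^ m"
    using p(1) by (simp add: lessThan_Suc_atMost[symmetric] c[symmetric] m_def)
  finally have "x ^ m = (\<Sum>i<m. of_int (- c i) * x ^ i)"
    by (simp add: sum_negf add_eq_0_iff)
  moreover have "m > 0"
  proof (rule ccontr)
    assume "\<not> m > 0"
    \<comment> \<open>For \<open>m = 0\<close> the equation just derived would read
      \<open>1 = 0\<close>.\<close>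
    then show False using calculation by simp
  qed
  ultimately show ?thesis by (rule that[rotated])
qed

text \<open>Multiplication by \<open>x\<close> and by \<open>y\<close> preserves the span of the
  monomials \<open>x ^ i * y ^ j\<close> with \<open>i < m\<close>, \<open>j < n\<close>, since the
  powers \<open>x ^ m\<close> and \<open>y ^ n\<close> reduce. Hence so does multiplication by the
  sum and by the product, and the span contains 1.\<close>

lemma algebraic_int_plus_times:
  fixes x y :: "'a :: field"
  assumes "algebraic_int x" "algebraic_int y"
  shows algebraic_int_plus: "algebraic_int (x + y)"
    and algebraic_int_times: "algebraic_int (x * y)"
proof -
  obtain c :: "nat \<Rightarrow> int" and m where m: "m > 0" "x ^ m = (\<Sum>k<m. of_int (c k) * x ^ k)"
    using algebraic_int_power_reduction[OF assms(1)] .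
  obtain d :: "nat \<Rightarrow> int" and n where n: "n > 0" "y ^ n = (\<Sum>k<n. of_int (d k) * y ^ k)"
    using algebraic_int_power_reduction[OF assms(2)] .
  define v where "v = (\<lambda>(i, j). x ^ i * y ^ j)"
  define I where "I = {..<m} \<times> {..<n}"
  have fin: "finite I" by (simp add: I_def)
  have nz: "\<exists>i\<in>I. v i \<noteq> 0"
    using m(1) n(1) by (intro bexI[of _ "(0, 0)"]) (auto simp: v_def I_def)
  have base: "x ^ i * y ^ j \<in> int_span v I" if "i < m" "j < n" for i j
    using int_span_base[OF fin, of "(i, j)" v] that by (simp add: v_def I_def)
  have x: "x * v p \<in> int_span v I" if pI: "p \<in> I" for p
  proof -
    obtain i j where ij: "p = (i, j)" "i < m" "j < n" using pI by (auto simp: I_def)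
    show ?thesis
    proof (cases "Suc i < m")
      case True
      then show ?thesis using base[of "Suc i" j] ij by (simp add: v_def mult.assoc)
    next
      case False
      then have "x * x ^ i = x ^ m" using ij by (metis Suc_lessI power_Suc)
      then have "x * v p = (\<Sum>k<m. of_int (c k) * (x ^ k * y ^ j))"
        using m(2) by (simp add: ij v_def mult.assoc[symmetric] sum_distrib_right)
      then show ?thesis using ij base by (auto intro!: int_span_sum int_span_of_int_mult)
    qed
  qed
  have y: "y * v p \<in> int_span v I" if pI: "p \<in> I" for p
  proof -
    obtain i j where ij: "p = (i, j)" "i < m" "j < n" using pI by (auto simp: I_def)
    show ?thesis
    proof (cases "Suc j < n")
      case True
      then show ?thesis using base[of i "Suc j"] ij by (simp add: v_def mult.left_commute)
    next
      case False
      then have "y * y ^ j = y ^ n" using ij by (metis Suc_lessI power_Suc)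
      then have "y * v p = x ^ i * (\<Sum>k<n. of_int (d k) * y ^ k)"
        using n(2) by (simp add: ij v_def mult.left_commute)
      also have "\<dots> = (\<Sum>k<n. of_int (d k) * (x ^ i * y ^ k))"
        by (simp add: sum_distrib_left mult.left_commute)
      finally show ?thesis using ij base by (auto intro!: int_span_sum int_span_of_int_mult)
    qed
  qed
  show "algebraic_int (x + y)"
    using x y by (intro algebraic_int_if_stable_span[OF fin nz]) (simp add: distrib_right int_span_add)
  show "algebraic_int (x * y)"
    using x y by (intro algebraic_int_if_stable_span[OF fin nz])
      (simp add: mult.assoc int_span_mult)
qed

lemma algebraic_int_diff:
  fixes x y :: "'a :: field"
  shows "algebraic_int x \<Longrightarrow> algebraic_int y \<Longrightarrow> algebraic_int (x - y)"
  using algebraic_int_plus[of x "- y"] by auto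

section \<open>Cyclic convolution modulo 2\<close>

text \<open>Frobenius: the mixed term of a square has the factor 2 and vanishes.\<close>

lemma power2_add_char2:
  fixes x y :: "bit poly"
  shows "(x + y) ^ (2 ^ n) = x ^ (2 ^ n) + y ^ (2 ^ n)"
proof (induction n)
  case (Suc n)
  have two: "(2 :: bit poly) = 0"
    by (metis bit_2_eq_0 numeral_poly pCons_0_0)
  have "(x + y) ^ (2 ^ Suc n) = ((x + y) ^ (2 ^ n))\<^sup>2"
    by (simp add: power_mult[symmetric] mult.commute)
  also have "\<dots> = (x ^ 2 ^ n)\<^sup>2 + (y ^ 2 ^ n)\<^sup>2"
    by (simp add: Suc power2_sum two)
  finally show ?case by (simp add: power_mult[symmetric] mult.commute)
qed simp

text \<open>In \<open>GF(2)[x] / (x\<^sup>N - 1)\<close> with \<open>N = 2\<^sup>n\<close> every \<open>F\<close> with \<open>F(1) = 1\<close> satisfies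
  \<open>F\<^sup>N = 1\<close>, so cyclic convolution with the coefficients of \<open>F\<close> is injective.\<close>

lemma cyclic_convolution_eq_0_imp:
  fixes a f :: "nat \<Rightarrow> bit"
  assumes per: "\<And>i. f (i + 2 ^ n) = f i"
    and odd: "(\<Sum>i<2 ^ n. f i) = 1"
    and conv: "\<And>j. j < 2 ^ n \<Longrightarrow> (\<Sum>i<2 ^ n. a i * f (i + j)) = 0"
    and i: "i < 2 ^ n"
  shows "a i = 0"
proof -
  define N :: nat where "N = 2 ^ n"
  define T :: "bit poly" where "T = [:0, 1:]"
  \<comment> \<open>\<open>F j\<close> lists \<open>f\<close> from index \<open>j\<close> on with
    descending exponents. Thus multiplication by \<open>T\<close> shifts it to
    \<open>F (Suc j)\<close> modulo \<open>T ^ N - 1\<close>, and the coefficients of the sum of the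
    \<open>[:a i:] * F i\<close> are the convolutions assumed to vanish.\<close>
  define F where "F = (\<lambda>j. \<Sum>k<N. [:f (k + j):] * T ^ (N - 1 - k))"
  define p where "p = (\<Sum>i<N. [:a i:] * T ^ i)"
  have N0: "N > 0" by (simp add: N_def)
  have perN: "f (k + N) = f k" for k using per by (simp add: N_def)
  have step: "T * F j - F (Suc j) = [:f j:] * (T ^ N - 1)" for j
  proof -
    obtain M where M: "N = Suc M" using N0 by (cases N) auto
    have "T * F j = (\<Sum>k<Suc M. [:f (k + j):] * T ^ (Suc M - k))"
      unfolding F_def M sum_distrib_left
      by (intro sum.cong refl) (auto simp: mult.left_commute Suc_diff_le simp flip: power_Suc)
    also have "\<dots> = [:f j:] * T ^ N + (\<Sum>k<M. [:f (Suc k + j):] * T ^ (M - k))"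
      by (subst sum.lessThan_Suc_shift) (simp add: M)
    finally have 1: "T * F j = [:f j:] * T ^ N + (\<Sum>k<M. [:f (Suc k + j):] * T ^ (M - k))" .
    have "F (Suc j) = (\<Sum>k<M. [:f (Suc k + j):] * T ^ (M - k)) + [:f j:]"
      using perN[of j] unfolding F_def M by (simp add: add.commute)
    then show ?thesis unfolding 1 by (simp add: algebra_simps)
  qed
  have shift: "(T ^ N - 1) dvd T ^ j * F 0 - F j" for j
  proof (induction j)
    case (Suc j)
    have "T ^ Suc j * F 0 - F (Suc j) = T * (T ^ j * F 0 - F j) + (T * F j - F (Suc j))"
      by (simp add: algebra_simps)
    then show ?case using Suc step[of j] by (metis dvd_add dvd_mult dvd_triv_right)
  qed simp
  have const: "(\<Sum>i<M. [:g i:]) = [:\<Sum>i<M. g i:]" for M and g :: "nat \<Rightarrow> bit"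
    by (induction M) auto
  have "(\<Sum>i<N. [:a i:] * F i) = (\<Sum>k<N. (\<Sum>i<N. [:a i * f (i + k):]) * T ^ (N - 1 - k))"
    unfolding F_def sum_distrib_left sum_distrib_right
    by (subst sum.swap) (simp add: mult.assoc[symmetric] add.commute conj_commute)
  also have "\<dots> = (\<Sum>k<N. [:\<Sum>i<N. a i * f (i + k):] * T ^ (N - 1 - k))"
    by (simp only: const)
  also have "\<dots> = 0" using conv by (simp add: N_def)
  finally have aF: "(\<Sum>i<N. [:a i:] * F i) = 0" .
  \<comment> \<open>Modulo \<open>T ^ N - 1\<close> each \<open>T ^ i * F 0\<close> becomes
    \<open>F i\<close>, so \<open>p * F 0\<close> becomes a sum already known to be 0.\<close>
  have "p * F 0 = (\<Sum>i<N. [:a i:] * (T ^ i * F 0 - F i)) + (\<Sum>i<N. [:a i:] * F i)"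
    unfolding p_def by (simp add: sum_distrib_right sum.distrib[symmetric] right_diff_distrib mult.assoc del: mult_pCons_left)
  also have "(T ^ N - 1) dvd \<dots>"
    unfolding aF using shift by (intro dvd_add dvd_sum dvd_mult) auto
  \<comment> \<open>The additional factor completes \<open>F 0\<close> to its \<open>N\<close>-th
    power, which is shown below to be 1 modulo \<open>T ^ N - 1\<close>.\<close>
  finally have "(T ^ N - 1) dvd p * F 0 * F 0 ^ (N - 1)" by (rule dvd_mult2)
  then have dvd: "(T ^ N - 1) dvd p * F 0 ^ N"
    using N0 by (cases N) (auto simp: algebra_simps)
  \<comment> \<open>The value at 1 is the sum of the coefficients, so oddness of \<open>f\<close>
    makes \<open>F 0 - 1\<close> divisible by \<open>T - 1\<close>.\<close>
  have "poly (F 0) 1 = (\<Sum>k<N. f k)"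
    unfolding F_def poly_sum by (intro sum.cong refl) (simp add: T_def)
  then have "poly (F 0 - 1) 1 = 0" using odd by (simp add: N_def)
  then obtain r where "F 0 - 1 = [:- 1, 1:] * r"
    using poly_eq_0_iff_dvd by blast
  moreover have "[:- 1, 1:] = T - 1" by (simp add: T_def one_pCons)
  ultimately have "F 0 - 1 = (T - 1) * r" by metis
  then have F0: "F 0 = 1 + (T - 1) * r" by (metis diff_add_cancel add.commute)
  have "(T - 1) ^ N = T ^ N - 1"
    using power2_add_char2[of "T - 1" 1 n] by (simp add: N_def)
  then have FN: "F 0 ^ N = 1 + (T ^ N - 1) * r ^ N"
    unfolding F0 using power2_add_char2[of 1 "(T - 1) * r" n]
    by (simp add: N_def power_mult_distrib)
  have "p * F 0 ^ N = p + (T ^ N - 1) * (p * r ^ N)"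
    unfolding FN by (simp only: distrib_left mult_1_right mult.left_commute)
  with dvd have dvdp: "(T ^ N - 1) dvd p" by (metis dvd_add_left_iff dvd_triv_left)
  have coeff_p: "coeff p k = (if k < N then a k else 0)" for k
  proof -
    have "p = (\<Sum>i<N. monom (a i) i)"
      unfolding p_def T_def by (intro sum.cong refl) (simp add: monom_altdef)
    then have "coeff p k = (\<Sum>i<N. if i = k then a i else 0)"
      by (simp only: coeff_sum coeff_monom)
    then show ?thesis by simp
  qed
  have "T ^ N - 1 = monom 1 N + (- 1)" by (simp add: T_def monom_altdef)
  moreover have "degree (monom (1 :: bit) N + (- 1)) = degree (monom (1 :: bit) N)"
    using N0 by (intro degree_add_eq_left) (simp add: degree_monom_eq)
  ultimately have "degree (T ^ N - 1) = N" by (simp only: degree_monom_eq[OF one_neq_zero])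
  moreover have "degree p < N"
    using N0 by (intro degree_lessI) (auto simp: coeff_p)
  \<comment> \<open>A nonzero multiple of \<open>T ^ N - 1\<close> would have degree at least
    \<open>N\<close>.\<close>
  ultimately have "p = 0" using dvdp dvd_imp_degree_le by force
  then show ?thesis using coeff_p[of i] i by (simp add: N_def)
qed

section \<open>Free actions of cyclic 2-groups\<close>

lemma funpow_double: "(f ^^ (2 ^ Suc j)) x = (f ^^ 2 ^ j) ((f ^^ 2 ^ j) x)"
  using funpow_add[of "2 ^ j" "2 ^ j" f] by (simp add: mult_2)

lemma funpow_mult_fixed: "(f ^^ m) x = x \<Longrightarrow> (f ^^ (m * k)) x = x"
  by (induction k) (auto simp: funpow_add)

text \<open>Bezout in its additive form over the naturals avoids negative iterates, so
  \<open>f\<close> may be an arbitrary function.\<close>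

lemma funpow_gcd_fixed:
  assumes "(f ^^ a) x = x" "(f ^^ b) x = x"
  shows "(f ^^ gcd a b) x = x"
proof (cases "a = 0")
  case False
  then obtain u v where "a * u = b * v + gcd a b" using bezout_nat by blast
  then have "(f ^^ (gcd a b + b * v)) x = x"
    using funpow_mult_fixed[OF assms(1), of u] by (simp add: add.commute)
  then show ?thesis using funpow_mult_fixed[OF assms(2), of v] by (simp add: funpow_add)
qed (use assms in simp)

text \<open>Every orbit has exactly \<open>2 ^ n\<close> elements: a shorter period would yield one
  that is a power of 2 dividing \<open>2 ^ (n - 1)\<close>, which \<open>free\<close> forbids. The
  orbits partition \<open>S\<close>.\<close>

lemma two_power_dvd_card_if_free:
  assumes fin: "finite S" and maps: "\<And>x. x \<in> S \<Longrightarrow> f x \<in> S" and "n \<ge> 1"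
    and per: "\<And>x. x \<in> S \<Longrightarrow> (f ^^ 2 ^ n) x = x"
    and free: "\<And>x. x \<in> S \<Longrightarrow> (f ^^ 2 ^ (n - 1)) x \<noteq> x"
  shows "2 ^ n dvd card S"
proof -
  define N :: nat where "N = 2 ^ n"
  have N0: "N > 0" by (simp add: N_def)
  define orb where "orb = (\<lambda>x. range (\<lambda>i. (f ^^ i) x))"
  have perN: "(f ^^ N) x = x" if "x \<in> S" for x using per[OF that] by (simp add: N_def)
  have iter: "(f ^^ i) x \<in> S" if "x \<in> S" for i x
    by (induction i) (auto simp: maps that)
  have no_small: "(f ^^ d) y \<noteq> y" if "y \<in> S" "0 < d" "d < N" for d y
  proof
    assume "(f ^^ d) y = y"
    then have g: "(f ^^ gcd d (2 ^ n)) y = y"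
      using per that by (intro funpow_gcd_fixed)
    obtain i where i: "gcd d (2 ^ n) = 2 ^ i" "i \<le> n"
      using divides_primepow_nat[of 2 "gcd d (2 ^ n)" n] two_is_prime_nat by auto
    have "gcd d (2 ^ n) \<le> d" using that by (intro dvd_imp_le) auto
    then have "(2 :: nat) ^ i < 2 ^ n"
      using that(3) unfolding i(1) N_def by (rule le_less_trans)
    then have "i \<le> n - 1" by simp
    then have "(2 :: nat) ^ (n - 1) = 2 ^ i * 2 ^ (n - 1 - i)"
      by (metis le_add_diff_inverse power_add)
    then show False
      using free[OF that(1)] funpow_mult_fixed[OF g[unfolded i(1)]] by metis
  qed
  have orb_eq: "orb x = (\<lambda>i. (f ^^ i) x) ` {..<N}" if "x \<in> S" for x
  proof -
    have "(f ^^ i) x \<in> (\<lambda>i. (f ^^ i) x) ` {..<N}" for i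
      using funpow_mod_eq[OF perN[OF that], of i] N0
      by (intro image_eqI[of _ _ "i mod N"]) auto
    then show ?thesis by (auto simp: orb_def)
  qed
  have card_orb: "card (orb x) = N" if x: "x \<in> S" for x
  proof -
    have "(f ^^ i) x \<noteq> (f ^^ j) x" if "i < j" "j < N" for i j
    proof -
      have "(f ^^ (j - i)) ((f ^^ i) x) = (f ^^ j) x"
        using that by (metis comp_apply funpow_add le_add_diff_inverse2 less_imp_le)
      then show ?thesis using no_small[OF iter[OF x], of "j - i" i] that
        by (metis less_imp_diff_less zero_less_diff)
    qed
    then have "inj_on (\<lambda>i. (f ^^ i) x) {..<N}"
      by (intro linorder_inj_onI) auto
    then show ?thesis using x by (simp add: orb_eq card_image)
  qed
  have orb_of_mem: "orb z = orb x" if x: "x \<in> S" and z: "z \<in> orb x" for x z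
  proof -
    obtain i where i: "z = (f ^^ i) x" using z by (auto simp: orb_def)
    \<comment> \<open>\<open>N * i\<close> is a multiple of the period that is at least
      \<open>i\<close>, so iterating on from \<open>z\<close> returns to \<open>x\<close>.\<close>
    have "i \<le> N * i" using N0 by simp
    then have "(f ^^ (N * i - i)) z = x"
      using funpow_mult_fixed[OF perN[OF x], of i] unfolding i
      by (metis comp_apply funpow_add le_add_diff_inverse2)
    moreover have "orb ((f ^^ k) y) \<subseteq> orb y" for k y
      by (auto simp: orb_def) (metis comp_apply funpow_add rangeI)
    ultimately show ?thesis using i by (metis subset_antisym)
  qed
  have self: "x \<in> orb x" for x unfolding orb_def by (rule range_eqI[of _ _ 0]) simp
  have sub: "orb x \<subseteq> S" if "x \<in> S" for x using iter[OF that] by (auto simp: orb_def)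
  have U: "\<Union> (orb ` S) = S" using self sub by blast
  have "N * card (orb ` S) = card (\<Union> (orb ` S))"
  proof (rule card_partition)
    fix c1 c2 assume c: "c1 \<in> orb ` S" "c2 \<in> orb ` S" "c1 \<noteq> c2"
    then obtain x y where xy: "c1 = orb x" "x \<in> S" "c2 = orb y" "y \<in> S" by auto
    show "c1 \<inter> c2 = {}"
    proof (rule ccontr)
      assume "c1 \<inter> c2 \<noteq> {}"
      then obtain z where "z \<in> orb x" "z \<in> orb y" using xy by auto
      then show False using orb_of_mem xy c(3) by metis
    qed
  qed (use fin U card_orb in auto)
  then show ?thesis unfolding U N_def by (metis dvd_triv_left)
qed

section \<open>Primary parts of quotients of abelian groups\<close>

lemma (in group) r_coset_eq_self_iff:
  "subgroup H G \<Longrightarrow> x \<in> carrier G \<Longrightarrow> H #> x = H \<longleftrightarrow> x \<in> H"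
  using coset_join1 coset_join2 by blast

text \<open>The divisors of a power of the prime \<open>l\<close> are powers of \<open>l\<close>, so
  the exact order of a class can be replaced by a condition on any representative.\<close>

lemma primary_part_FactGroup:
  assumes R: "comm_group R" and A: "subgroup A R" and l: "Factorial_Ring.prime l"
  shows "primary_part l (R Mod A) =
    (\<lambda>x. A #>\<^bsub>R\<^esub> x) ` {x \<in> carrier R. \<exists>k. x [^]\<^bsub>R\<^esub> (l ^ k) \<in> A}"
proof -
  interpret R: comm_group R by (rule R)
  have N: "A \<lhd> R" using A by (rule R.subgroup_imp_normal)
  interpret N: normal A R by (rule N)
  interpret Q: group "R Mod A" by (rule N.factorgroup_is_group)
  have "(\<exists>k. Q.ord (A #>\<^bsub>R\<^esub> x) = l ^ k) \<longleftrightarrow> (\<exists>k. x [^]\<^bsub>R\<^esub> (l ^ k) \<in> A)"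
    if x: "x \<in> carrier R" for x
  proof -
    have Y: "A #>\<^bsub>R\<^esub> x \<in> carrier (R Mod A)" using x by (auto simp: carrier_FactGroup)
    have "(\<exists>k. Q.ord (A #>\<^bsub>R\<^esub> x) = l ^ k) \<longleftrightarrow> (\<exists>k. Q.ord (A #>\<^bsub>R\<^esub> x) dvd l ^ k)"
      using divides_primepow_nat[OF l] by blast
    also have "\<dots> \<longleftrightarrow> (\<exists>k. A #>\<^bsub>R\<^esub> (x [^]\<^bsub>R\<^esub> (l ^ k)) = A)"
      using Q.pow_eq_id[OF Y, symmetric] N.FactGroup_pow[OF x] by simp
    also have "\<dots> \<longleftrightarrow> (\<exists>k. x [^]\<^bsub>R\<^esub> (l ^ k) \<in> A)"
      using R.r_coset_eq_self_iff[OF A] x by simp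
    finally show ?thesis .
  qed
  then show ?thesis
    unfolding primary_part_def carrier_FactGroup by auto
qed

lemma card_primary_part_eq_1:
  assumes R: "comm_group R" and A: "subgroup A R" and l: "Factorial_Ring.prime l"
    and trivial: "\<And>x k. x \<in> carrier R \<Longrightarrow> x [^]\<^bsub>R\<^esub> (l ^ k) \<in> A \<Longrightarrow> x \<in> A"
  shows "card (primary_part l (R Mod A)) = 1"
proof -
  interpret R: comm_group R by (rule R)
  have "A #>\<^bsub>R\<^esub> x = A" if "x \<in> A" for x
    using that R.coset_join2[OF _ A] subgroup.mem_carrier[OF A] by blast
  moreover have "\<one>\<^bsub>R\<^esub> \<in> {x \<in> carrier R. \<exists>k. x [^]\<^bsub>R\<^esub> (l ^ k) \<in> A}"
    using subgroup.one_closed[OF A] by simp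
  ultimately have "(\<lambda>x. A #>\<^bsub>R\<^esub> x) ` {x \<in> carrier R. \<exists>k. x [^]\<^bsub>R\<^esub> (l ^ k) \<in> A} = {A}"
    using trivial by blast
  then show ?thesis by (simp add: primary_part_FactGroup[OF R A l])
qed

text \<open>Taking images under \<open>\<phi>\<close> permutes the nontrivial classes of the primary
  part. Its iterate of order \<open>2 ^ (n - 1)\<close> is inversion, which fixes none of them
  because \<open>l\<close> is odd, so orbit counting applies.\<close>

lemma card_primary_part_cong_1:
  assumes R: "comm_group R" and A: "subgroup A R"
    and l: "Factorial_Ring.prime l" "l \<noteq> 2" and n: "n \<ge> 1"
    and hom: "\<phi> \<in> hom R R" and stable: "\<And>a. a \<in> A \<Longrightarrow> \<phi> a \<in> A"
    and inv: "\<And>x. x \<in> carrier R \<Longrightarrow> (\<phi> ^^ 2 ^ (n - 1)) x = inv\<^bsub>R\<^esub> x"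
    and fin: "finite (primary_part l (R Mod A))"
  shows "[card (primary_part l (R Mod A)) = 1] (mod 2 ^ n)"
proof -
  interpret R: comm_group R by (rule R)
  have N: "A \<lhd> R" using A by (rule R.subgroup_imp_normal)
  interpret N: normal A R by (rule N)
  interpret Q: group "R Mod A" by (rule N.factorgroup_is_group)
  interpret \<phi>: group_hom R R \<phi> by unfold_locales (rule hom)
  define cls where "cls = (\<lambda>x. A #>\<^bsub>R\<^esub> x)"
  define P where "P = {x \<in> carrier R. \<exists>k. x [^]\<^bsub>R\<^esub> (l ^ k) \<in> A}"
  have prim: "primary_part l (R Mod A) = cls ` P"
    unfolding cls_def P_def by (rule primary_part_FactGroup[OF R A l(1)])
  have cls_A: "cls x = A \<longleftrightarrow> x \<in> A" if "x \<in> carrier R" for x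
    unfolding cls_def using A that by (rule R.r_coset_eq_self_iff)
  have iter: "(\<phi> ^^ k) x \<in> carrier R" if "x \<in> carrier R" for k x
    by (induction k) (auto simp: that)
  have iterA: "(\<phi> ^^ k) x \<in> A" if "x \<in> A" for k x
    by (induction k) (auto simp: that stable)
  have per: "(\<phi> ^^ 2 ^ n) x = x" if "x \<in> carrier R" for x
  proof -
    obtain m where m: "n = Suc m" using n by (cases n) auto
    show ?thesis using inv[OF that] inv[of "inv\<^bsub>R\<^esub> x"] that unfolding m funpow_double by simp
  qed
  have go_back: "(\<phi> ^^ (2 ^ n - 1)) (\<phi> x) = x" if "x \<in> carrier R" for x
    using per[OF that] by (metis One_nat_def Suc_pred comp_apply funpow_Suc_right pos2 zero_less_power)
  \<comment> \<open>Some iterate of \<open>\<phi>\<close> inverts \<open>\<phi>\<close> on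
    \<open>R\<close> and preserves \<open>A\<close>; hence cosets of \<open>A\<close> are mapped
    onto full cosets.\<close>
  have \<phi>A: "\<phi> ` A = A"
  proof (intro equalityI subsetI)
    fix a assume a: "a \<in> A"
    have "\<phi> ((\<phi> ^^ (2 ^ n - 1)) a) = a"
      using go_back[of a] a N.subset by (metis funpow_swap1 subsetD)
    then show "a \<in> \<phi> ` A" using iterA[OF a] by (metis image_eqI)
  qed (use stable in auto)
  have img: "image \<phi> (cls x) = cls (\<phi> x)" if x: "x \<in> carrier R" for x
  proof -
    have "image \<phi> (cls x) = (\<lambda>a. \<phi> a \<otimes>\<^bsub>R\<^esub> \<phi> x) ` A"
      unfolding cls_def r_coset_def using x N.subset by (auto simp: image_iff subset_iff)
    also have "\<dots> = (\<lambda>a. a \<otimes>\<^bsub>R\<^esub> \<phi> x) ` (\<phi> ` A)" by (simp only: image_image)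
    finally show ?thesis unfolding \<phi>A cls_def r_coset_def by auto
  qed
  have img_iter: "(image \<phi> ^^ k) (cls x) = cls ((\<phi> ^^ k) x)" if "x \<in> carrier R" for k x
    by (induction k) (auto simp: img iter that)
  define S where "S = cls ` P - {A}"
  have S: "\<exists>x k. Y = cls x \<and> x \<in> carrier R \<and> x \<notin> A \<and> x [^]\<^bsub>R\<^esub> (l ^ k) \<in> A" if "Y \<in> S" for Y
    using that cls_A unfolding S_def P_def by blast
  have "2 ^ n dvd card S"
  proof (rule two_power_dvd_card_if_free[where f = "image \<phi>"])
    show "finite S" using fin unfolding S_def prim by simp
    show "image \<phi> Y \<in> S" if Y: "Y \<in> S" for Y
    proof -
      obtain x k where x: "Y = cls x" "x \<in> carrier R" "x \<notin> A" "x [^]\<^bsub>R\<^esub> (l ^ k) \<in> A"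
        using S[OF Y] by blast
      have "\<phi> x \<notin> A" using iterA[of "\<phi> x"] go_back[OF x(2)] x(3) by metis
      moreover have "\<phi> x [^]\<^bsub>R\<^esub> (l ^ k) \<in> A"
        using stable[OF x(4)] x(2) by (simp add: \<phi>.hom_nat_pow)
      ultimately show ?thesis
        using x cls_A[of "\<phi> x"] by (auto simp: S_def P_def img)
    qed
    show "(image \<phi> ^^ 2 ^ n) Y = Y" if "Y \<in> S" for Y
      using S[OF that] by (auto simp: img_iter per)
    show "(image \<phi> ^^ 2 ^ (n - 1)) Y \<noteq> Y" if Y: "Y \<in> S" for Y
    proof
      obtain x k where x: "Y = cls x" "x \<in> carrier R" "x \<notin> A" "x [^]\<^bsub>R\<^esub> (l ^ k) \<in> A"
        using S[OF Y] by blast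
      assume "(image \<phi> ^^ 2 ^ (n - 1)) Y = Y"
      then have eq: "cls (inv\<^bsub>R\<^esub> x) = cls x"
        by (simp only: x(1) img_iter[OF x(2)] inv[OF x(2)])
      have Q: "cls x \<in> carrier (R Mod A)" using x by (auto simp: carrier_FactGroup cls_def)
      have pow: "cls x [^]\<^bsub>R Mod A\<^esub> (m :: nat) = cls (x [^]\<^bsub>R\<^esub> m)" for m
        unfolding cls_def by (rule N.FactGroup_pow[OF x(2)])
      \<comment> \<open>A class equal to its own inverse has order dividing 2 and also dividing
        \<open>l ^ k\<close>, hence order 1.\<close>
      have "cls (x [^]\<^bsub>R\<^esub> (2 :: nat)) = cls (x \<otimes>\<^bsub>R\<^esub> x)"
        using x(2) by (simp add: numeral_2_eq_2)
      also have "\<dots> = cls (inv\<^bsub>R\<^esub> x) <#>\<^bsub>R\<^esub> cls x"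
        unfolding eq unfolding cls_def using x(2) by (intro N.rcos_sum[symmetric])
      also have "\<dots> = cls (inv\<^bsub>R\<^esub> x \<otimes>\<^bsub>R\<^esub> x)"
        unfolding cls_def using x(2) by (intro N.rcos_sum) auto
      also have "\<dots> = A" using x(2) cls_A[of "\<one>\<^bsub>R\<^esub>"] by simp
      finally have "cls x [^]\<^bsub>R Mod A\<^esub> (2 :: nat) = \<one>\<^bsub>R Mod A\<^esub>" by (simp add: pow)
      then have "Q.ord (cls x) dvd 2" using Q.pow_eq_id[OF Q] by blast
      moreover have "Q.ord (cls x) dvd l ^ k"
        using Q.pow_eq_id[OF Q] pow x(2,4) cls_A[of "x [^]\<^bsub>R\<^esub> (l ^ k)"] by simp
      moreover have "coprime 2 (l ^ k)"
        using l by (metis coprime_power_right_iff primes_coprime two_is_prime_nat)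
      ultimately have "Q.ord (cls x) = 1" using coprime_common_divisor_nat by blast
      then have "cls x = A" using Q.ord_eq_1[OF Q] by simp
      then show False using cls_A x by blast
    qed
  qed (rule n)
  \<comment> \<open>The trivial class \<open>A\<close>, removed from \<open>S\<close>, contributes
    the residue 1.\<close>
  moreover have "card (cls ` P) = Suc (card S)"
  proof -
    have "\<one>\<^bsub>R\<^esub> \<in> P" by (simp add: P_def)
    moreover have "cls \<one>\<^bsub>R\<^esub> = A" by (simp add: cls_A)
    ultimately have "A \<in> cls ` P" by (metis imageI)
    then show ?thesis using fin unfolding S_def prim by (metis card_Suc_Diff1)
  qed
  ultimately show ?thesis
    unfolding prim cong_def by (metis Suc_eq_plus1_left mod_mult_self2 dvdE)
qed

section \<open>The tower of fields\<close>

lemma gen_X_0: "gen_X 0 = 0"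
  by (simp add: gen_X_def)

lemma gen_X_Suc_sq: "gen_X (Suc j) ^ 2 = 2 + gen_X j"
proof -
  have "2 * (2 * pi / 2 ^ (Suc j + 2)) = 2 * pi / 2 ^ (j + 2)" by simp
  then show ?thesis
    using cos_double_cos[of "2 * pi / 2 ^ (Suc j + 2)"]
    by (simp add: gen_X_def power2_eq_square)
qed

text \<open>The angle is positive and at most \<open>pi / 4\<close>. Nonvanishing later lets a
  factor \<open>gen_X (Suc j)\<close> be cancelled.\<close>

lemma gen_X_Suc_neq_0: "gen_X (Suc j) \<noteq> 0"
proof -
  have "(8 :: real) \<le> 2 ^ (Suc j + 2)" using one_le_power[of "2 :: real" j] by simp
  then have "2 * pi / 2 ^ (Suc j + 2) \<le> 2 * pi / 8" by (intro divide_left_mono) auto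
  also have "\<dots> < pi / 2" using pi_gt_zero by simp
  finally have "2 * pi / 2 ^ (Suc j + 2) < pi / 2" .
  moreover have "- (pi / 2) < 2 * pi / 2 ^ (Suc j + 2)"
    using pi_gt_zero by (smt (verit) divide_pos_pos zero_less_power)
  ultimately have "cos (2 * pi / 2 ^ (Suc j + 2)) > 0" by (intro cos_gt_zero_pi)
  then show ?thesis by (simp add: gen_X_def)
qed

text \<open>An explicit model of the field \<open>B_j\<close>, one square root adjoined at a time,
  made for induction on \<open>j\<close>; it is identified with \<open>field_B\<close> in
  \<open>carrier_field_B\<close>.\<close>

fun tower :: "nat \<Rightarrow> real set" where
  "tower 0 = \<rat>"
| "tower (Suc j) = {a + b * gen_X (Suc j) | a b. a \<in> tower j \<and> b \<in> tower j}"

lemma tower_SucI: "a \<in> tower j \<Longrightarrow> b \<in> tower j \<Longrightarrow> a + b * gen_X (Suc j) \<in> tower (Suc j)"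
  by auto

lemma tower_SucE:
  assumes "x \<in> tower (Suc j)"
  obtains a b where "a \<in> tower j" "b \<in> tower j" "x = a + b * gen_X (Suc j)"
  using assms by auto

declare tower.simps(2)[simp del]

lemma Rats_subset_tower: "x \<in> \<rat> \<Longrightarrow> x \<in> tower j"
proof (induction j arbitrary: x)
  case (Suc j)
  then show ?case using tower_SucI[of x j 0] by simp
qed simp

lemma tower_Suc_mono: "x \<in> tower j \<Longrightarrow> x \<in> tower (Suc j)"
  using tower_SucI[of x j 0] Rats_subset_tower[of 0 j] by simp

lemma tower_mono: "i \<le> j \<Longrightarrow> x \<in> tower i \<Longrightarrow> x \<in> tower j"
  by (induction rule: dec_induct) (auto intro: tower_Suc_mono)

lemma gen_X_in_tower: "gen_X j \<in> tower j"
proof (cases j)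
  case (Suc i)
  then show ?thesis
    using tower_SucI[of 0 i 1] Rats_subset_tower[of 0 i] Rats_subset_tower[of 1 i] by simp
qed (simp add: gen_X_0)

lemma tower_ring:
  assumes "x \<in> tower j" "y \<in> tower j"
  shows "x + y \<in> tower j \<and> x * y \<in> tower j"
  using assms
proof (induction j arbitrary: x y)
  case (Suc j)
  obtain a b where x: "a \<in> tower j" "b \<in> tower j" "x = a + b * gen_X (Suc j)"
    using Suc.prems(1) by (rule tower_SucE)
  obtain c d where y: "c \<in> tower j" "d \<in> tower j" "y = c + d * gen_X (Suc j)"
    using Suc.prems(2) by (rule tower_SucE)
  have "x + y = (a + c) + (b + d) * gen_X (Suc j)"
    by (simp add: x y algebra_simps)
  moreover have "x * y = (a * c + b * d * (2 + gen_X j)) + (a * d + b * c) * gen_X (Suc j)"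
    unfolding x y gen_X_Suc_sq[symmetric] by (simp add: algebra_simps power2_eq_square)
  moreover have "2 + gen_X j \<in> tower j"
    using Suc.IH gen_X_in_tower Rats_subset_tower by simp
  ultimately show ?case using Suc.IH x y by (metis tower_SucI)
qed auto

lemma tower_add: "x \<in> tower j \<Longrightarrow> y \<in> tower j \<Longrightarrow> x + y \<in> tower j"
  and tower_mult: "x \<in> tower j \<Longrightarrow> y \<in> tower j \<Longrightarrow> x * y \<in> tower j"
  using tower_ring by auto

lemma tower_minus: "x \<in> tower j \<Longrightarrow> - x \<in> tower j"
  using tower_mult[of "-1" j x] Rats_subset_tower[of "-1" j] by simp

lemma tower_diff: "x \<in> tower j \<Longrightarrow> y \<in> tower j \<Longrightarrow> x - y \<in> tower j"
  using tower_add[of x j "- y"] tower_minus[of y j] by simp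

text \<open>The denominator is rationalized with the conjugate \<open>a - b * T\<close>. When that
  conjugate is 0, \<open>x = 2 * a\<close> already lies one level lower; this case covers the
  possibility that \<open>T\<close> is in \<open>tower j\<close>.\<close>

lemma tower_inverse: "x \<in> tower j \<Longrightarrow> inverse x \<in> tower j"
proof (induction j arbitrary: x)
  case (Suc j)
  define T where "T = gen_X (Suc j)"
  obtain a b where x: "a \<in> tower j" "b \<in> tower j" "x = a + b * T"
    using Suc.prems unfolding T_def by (rule tower_SucE)
  show ?case
  proof (cases "a = b * T")
    case True
    then have "x = 2 * a" by (simp add: x)
    then have "x \<in> tower j" using x Rats_subset_tower[of 2 j] by (simp add: tower_mult)
    then show ?thesis by (simp add: Suc.IH tower_Suc_mono)
  next
    case False
    define d where "d = inverse (a * a - b * b * (2 + gen_X j))"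
    have "2 + gen_X j \<in> tower j"
      by (simp add: tower_add gen_X_in_tower Rats_subset_tower)
    then have "d \<in> tower j"
      using x unfolding d_def by (intro Suc.IH tower_diff tower_mult) auto
    moreover have "a * a - b * b * (2 + gen_X j) = x * (a - b * T)"
      unfolding x T_def gen_X_Suc_sq[symmetric] by (simp add: algebra_simps power2_eq_square)
    then have d: "d = inverse x * inverse (a - b * T)" by (simp add: d_def)
    have "(a - b * T) * d = inverse x" using False by (simp add: d)
    then have "inverse x = a * d + (- b * d) * T" by (simp add: algebra_simps)
    ultimately show ?thesis
      using x unfolding T_def by (metis tower_SucI tower_mult tower_minus)
  qed
qed auto

lemma tower_prod: "(\<And>i. i \<in> I \<Longrightarrow> f i \<in> tower j) \<Longrightarrow> (\<Prod>i\<in>I. f i) \<in> tower j"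
  by (induction I rule: infinite_finite_induct) (auto intro: tower_mult Rats_subset_tower)

lemma tower_power: "x \<in> tower j \<Longrightarrow> x ^ k \<in> tower j"
  by (induction k) (auto intro: tower_mult Rats_subset_tower)

lemma tower_power_int: "x \<in> tower j \<Longrightarrow> x powi k \<in> tower j"
  by (simp add: power_int_def tower_power tower_inverse)

section \<open>The fields \<open>B_n\<close> and their unit groups in terms of the tower\<close>

lemma inv_ring_of_type_algebra:
  "(x :: real) \<noteq> 0 \<Longrightarrow> inv\<^bsub>ring_of_type_algebra\<^esub> x = inverse x"
proof -
  assume "x \<noteq> 0"
  interpret field "ring_of_type_algebra :: real ring" by rule
  show ?thesis
    using \<open>x \<noteq> 0\<close> by (intro comm_inv_char) (auto simp: ring_of_type_algebra_def)
qed

lemma a_inv_ring_of_type_algebra: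
  "\<ominus>\<^bsub>ring_of_type_algebra\<^esub> (x :: real) = - x"
proof -
  interpret field "ring_of_type_algebra :: real ring" by rule
  show ?thesis
    by (rule minus_equality) (auto simp: ring_of_type_algebra_def)
qed

lemma carrier_field_B: "carrier (field_B n) = tower n"
proof -
  let ?R = "ring_of_type_algebra :: real ring"
  let ?G = "generate_field ?R (insert (gen_X n) \<rat>)"
  have simps: "x \<otimes>\<^bsub>?R\<^esub> y = x * y" "x \<oplus>\<^bsub>?R\<^esub> y = x + y" "\<one>\<^bsub>?R\<^esub> = 1" "\<zero>\<^bsub>?R\<^esub> = 0" for x y
    by (auto simp: ring_of_type_algebra_def)
  have "x \<in> tower n" if "x \<in> ?G" for x
    using that
  proof induction
    case (m_inv h)
    then show ?case by (simp add: inv_ring_of_type_algebra simps tower_inverse)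
  qed (auto simp: simps a_inv_ring_of_type_algebra
       intro: tower_add tower_mult tower_minus Rats_subset_tower gen_X_in_tower)
  \<comment> \<open>Descending from \<open>n\<close>, each lower generator is recovered as the
    square of the next one minus 2.\<close>
  moreover have T: "gen_X j \<in> ?G" if "j \<le> n" for j
    using that
  proof (induction rule: inc_induct)
    case base
    show ?case by (rule generate_field.incl) simp
  next
    case (step j)
    have "gen_X j = gen_X (Suc j) * gen_X (Suc j) + (- 2)"
      using gen_X_Suc_sq[of j] by (simp add: power2_eq_square)
    moreover have "- 2 \<in> ?G" by (rule generate_field.incl) simp
    ultimately show ?case
      using generate_field.eng_add[of _ ?R] generate_field.eng_mult[of _ ?R] step.IH simps by metis
  qed
  have "x \<in> ?G" if "j \<le> n" "x \<in> tower j" for j x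
    using that
  proof (induction j arbitrary: x)
    case 0
    then show ?case by (auto intro: generate_field.incl)
  next
    case (Suc j)
    obtain a b where "a \<in> tower j" "b \<in> tower j" "x = a + b * gen_X (Suc j)"
      using Suc.prems(2) by (rule tower_SucE)
    with Suc T[of "Suc j"] show ?case
      using generate_field.eng_add[of a ?R _ "b * gen_X (Suc j)"]
        generate_field.eng_mult[of b ?R _ "gen_X (Suc j)"] simps by auto
  qed
  then have "x \<in> ?G" if "x \<in> tower n" for x using that by blast
  ultimately show ?thesis by (auto simp: field_B_def)
qed

lemma field_B_simps:
  "monoid.mult (field_B n) = (*)" "add (field_B n) = (+)" "\<one>\<^bsub>field_B n\<^esub> = 1" "\<zero>\<^bsub>field_B n\<^esub> = 0"
  by (auto simp: field_B_def ring_of_type_algebra_def)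

lemma carrier_units_E:
  "carrier (units_E n) =
    {x \<in> tower n. x \<noteq> 0 \<and> algebraic_int x \<and> algebraic_int (inverse x)}"
proof -
  have *: "y = inverse x \<and> x \<noteq> 0" if "x * y = 1" for x y :: real
    using that by (metis inverse_unique mult_zero_left zero_neq_one)
  have "x \<in> carrier (units_E n) \<longleftrightarrow> x \<in> tower n \<and> algebraic_int x \<and>
      (\<exists>y\<in>tower n. algebraic_int y \<and> y * x = 1)" for x
    unfolding units_E_def units_of_def Units_def ring_of_integers_def
    by (auto simp: carrier_field_B field_B_simps mult.commute)
  moreover have "(\<exists>y\<in>tower n. algebraic_int y \<and> y * x = 1) \<longleftrightarrow> x \<noteq> 0 \<and> algebraic_int (inverse x)"
    if "x \<in> tower n" for x
    using that tower_inverse[of x n] *[of x] by (metis left_inverse mult.commute)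
  ultimately show ?thesis by (simp add: set_eq_iff conj_left_commute cong: conj_cong)
qed

lemma units_E_simps: "monoid.mult (units_E n) = (*)" "\<one>\<^bsub>units_E n\<^esub> = 1"
  by (auto simp: units_E_def units_of_def ring_of_integers_def field_B_simps)

lemma units_E_mult:
  "x \<in> carrier (units_E n) \<Longrightarrow> y \<in> carrier (units_E n) \<Longrightarrow> x * y \<in> carrier (units_E n)"
  by (auto simp: carrier_units_E tower_mult algebraic_int_times)

lemma units_E_inverse: "x \<in> carrier (units_E n) \<Longrightarrow> inverse x \<in> carrier (units_E n)"
  by (auto simp: carrier_units_E tower_inverse)

lemma comm_group_units_E: "comm_group (units_E n)"
proof (rule comm_groupI)
  fix x assume "x \<in> carrier (units_E n)"
  then show "\<exists>y\<in>carrier (units_E n). y \<otimes>\<^bsub>units_E n\<^esub> x = \<one>\<^bsub>units_E n\<^esub>"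
    by (intro bexI[of _ "inverse x"] units_E_inverse) (auto simp: units_E_simps carrier_units_E)
qed (auto simp: units_E_simps units_E_mult, auto simp: carrier_units_E Rats_subset_tower)

lemma inv_units_E: "x \<in> carrier (units_E n) \<Longrightarrow> inv\<^bsub>units_E n\<^esub> x = inverse x"
proof -
  interpret comm_group "units_E n" by (rule comm_group_units_E)
  assume "x \<in> carrier (units_E n)"
  then show ?thesis
    by (intro inv_equality units_E_inverse) (auto simp: units_E_simps carrier_units_E)
qed

lemma algebraic_int_gen_X: "algebraic_int (gen_X j)"
proof (induction j)
  case (Suc j)
  have "algebraic_int (2 + gen_X j)" using Suc by (intro algebraic_int_plus) auto
  then have "algebraic_int (gen_X (Suc j) ^ 2)" by (simp add: gen_X_Suc_sq)
  then show ?case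
    by (intro algebraic_int_root[where p = "monom 1 2" and x = "gen_X (Suc j)" and y = "gen_X (Suc j) ^ 2"])
      (auto simp: poly_monom degree_monom_eq)
qed (simp add: gen_X_0)

text \<open>The product of \<open>gen_X (Suc j) + 1\<close> and \<open>gen_X (Suc j) - 1\<close> is
  \<open>1 + gen_X j\<close>, so invertibility climbs from \<open>1 + gen_X 0 = 1\<close>.\<close>

lemma one_plus_gen_X_unit: "1 + gen_X j \<in> carrier (units_E j)"
proof (induction j)
  case 0
  then show ?case by (simp add: gen_X_0 carrier_units_E)
next
  case (Suc j)
  have eq: "(1 + gen_X (Suc j)) * (gen_X (Suc j) - 1) = 1 + gen_X j"
    using gen_X_Suc_sq[of j] by (simp add: algebra_simps power2_eq_square)
  have nz: "1 + gen_X (Suc j) \<noteq> 0" "1 + gen_X j \<noteq> 0"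
    using Suc eq by (auto simp: carrier_units_E)
  have "inverse (1 + gen_X (Suc j)) = (gen_X (Suc j) - 1) * inverse (1 + gen_X j)"
    using nz eq by (simp add: field_simps)
  moreover have "algebraic_int (gen_X (Suc j) - 1)"
    by (intro algebraic_int_diff algebraic_int_gen_X) auto
  ultimately have "algebraic_int (inverse (1 + gen_X (Suc j)))"
    using Suc by (auto simp: carrier_units_E intro: algebraic_int_times)
  then show ?case
    using nz by (auto simp: carrier_units_E algebraic_int_plus algebraic_int_gen_X tower_add gen_X_in_tower Rats_subset_tower)
qed

section \<open>Endomorphisms of the tower\<close>

text \<open>Nothing is required outside \<open>tower n\<close>, so the plain iterates
  \<open>\<sigma> ^^ k\<close> qualify, although powers taken in \<open>gal_G n\<close> are
  functions restricted to the field.\<close>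

locale tower_endo =
  fixes n :: nat and \<sigma> :: "real \<Rightarrow> real"
  assumes closed: "x \<in> tower n \<Longrightarrow> \<sigma> x \<in> tower n"
    and add: "x \<in> tower n \<Longrightarrow> y \<in> tower n \<Longrightarrow> \<sigma> (x + y) = \<sigma> x + \<sigma> y"
    and mult: "x \<in> tower n \<Longrightarrow> y \<in> tower n \<Longrightarrow> \<sigma> (x * y) = \<sigma> x * \<sigma> y"
    and rat: "x \<in> \<rat> \<Longrightarrow> \<sigma> x = x"
begin

lemma minus: "x \<in> tower n \<Longrightarrow> \<sigma> (- x) = - \<sigma> x"
  using mult[of "-1" x] by (simp add: rat Rats_subset_tower)

lemma diff: "x \<in> tower n \<Longrightarrow> y \<in> tower n \<Longrightarrow> \<sigma> (x - y) = \<sigma> x - \<sigma> y"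
  using add[of x "- y"] by (simp add: minus tower_minus)

lemma inverse: "x \<in> tower n \<Longrightarrow> \<sigma> (inverse x) = inverse (\<sigma> x)"
proof (cases "x = 0")
  case False
  assume "x \<in> tower n"
  then have "\<sigma> x * \<sigma> (inverse x) = 1"
    using mult[of x "inverse x"] False by (simp add: rat tower_inverse)
  then show ?thesis by (metis inverse_unique)
qed (simp add: rat)

lemma neq_0: "x \<in> tower n \<Longrightarrow> x \<noteq> 0 \<Longrightarrow> \<sigma> x \<noteq> 0"
  using mult[of x "inverse x"] by (auto simp: rat tower_inverse)

lemma power: "x \<in> tower n \<Longrightarrow> \<sigma> (x ^ k) = \<sigma> x ^ k"
  by (induction k) (auto simp: rat mult tower_power)

lemma power_int: "x \<in> tower n \<Longrightarrow> \<sigma> (x powi k) = \<sigma> x powi k"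
  by (simp add: power_int_def power inverse tower_inverse)

lemma prod: "(\<And>i. i \<in> I \<Longrightarrow> f i \<in> tower n) \<Longrightarrow> \<sigma> (\<Prod>i\<in>I. f i) = (\<Prod>i\<in>I. \<sigma> (f i))"
  by (induction I rule: infinite_finite_induct) (auto simp: rat mult tower_prod)

lemma sum: "(\<And>i. i \<in> I \<Longrightarrow> f i \<in> tower n) \<Longrightarrow>
  \<sigma> (\<Sum>i\<in>I. f i) = (\<Sum>i\<in>I. \<sigma> (f i)) \<and> (\<Sum>i\<in>I. f i) \<in> tower n"
  by (induction I rule: infinite_finite_induct) (auto simp: rat add Rats_subset_tower tower_add)

text \<open>An integral equation has coefficients fixed by \<open>\<sigma>\<close>, so the image
  satisfies the same equation.\<close>

lemma algebraic_int:
  assumes "x \<in> tower n" "algebraic_int x"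
  shows "algebraic_int (\<sigma> x)"
proof -
  from assms(2) obtain p where p: "lead_coeff p = 1" "\<And>i. coeff p i \<in> \<int>" "poly p x = 0"
    by (auto elim: algebraic_int.cases)
  have Q: "coeff p i \<in> \<rat>" for i using p(2)[of i] Ints_subset_Rats by blast
  have "poly p (\<sigma> x) = (\<Sum>i\<le>degree p. \<sigma> (coeff p i * x ^ i))"
    unfolding poly_altdef using assms(1) Q
    by (intro sum.cong refl) (simp add: mult power rat Rats_subset_tower tower_power)
  also have "\<dots> = \<sigma> (poly p x)"
    unfolding poly_altdef using assms(1) Q
    by (intro sum[THEN conjunct1, symmetric]) (simp add: Rats_subset_tower tower_power tower_mult)
  also have "\<dots> = 0" using p(3) by (simp add: rat)
  finally show ?thesis using p by (intro algebraic_int.intros[of p]) auto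
qed

lemma unit: "x \<in> carrier (units_E n) \<Longrightarrow> \<sigma> x \<in> carrier (units_E n)"
  using algebraic_int[of "inverse x"]
  by (auto simp: carrier_units_E closed neq_0 algebraic_int inverse tower_inverse)

lemma funpow: "tower_endo n (\<sigma> ^^ k)"
  by (induction k) (unfold_locales, auto simp: tower_endo_def closed add mult rat)

text \<open>The square \<open>2 + gen_X j\<close> is fixed, which leaves only a sign.\<close>

lemma gen_X_cases:
  assumes "j < n" and "\<sigma> (gen_X j) = gen_X j"
  shows "\<sigma> (gen_X (Suc j)) = gen_X (Suc j) \<or> \<sigma> (gen_X (Suc j)) = - gen_X (Suc j)"
proof -
  have t: "gen_X (Suc j) \<in> tower n" "gen_X j \<in> tower n"
    using assms(1) by (auto intro: tower_mono[OF _ gen_X_in_tower])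
  have "(\<sigma> (gen_X (Suc j)))\<^sup>2 = \<sigma> (2 + gen_X j)"
    using t by (simp add: power[symmetric] gen_X_Suc_sq)
  also have "\<dots> = (gen_X (Suc j))\<^sup>2"
    using t assms(2) by (simp add: add rat Rats_subset_tower gen_X_Suc_sq)
  finally show ?thesis by (simp add: power2_eq_iff)
qed

lemma double_fixes_gen_X:
  assumes "j < n" and "\<sigma> (gen_X j) = gen_X j"
  shows "\<sigma> (\<sigma> (gen_X (Suc j))) = gen_X (Suc j)"
  using gen_X_cases[OF assms] assms(1)
  by (auto simp: minus tower_mono[OF _ gen_X_in_tower])

end

context tower_endo
begin

text \<open>Passing up one level introduces at most a sign, and doubling the number of iterations
  removes it.\<close>

lemma funpow_fixes_gen_X: "j \<le> n \<Longrightarrow> (\<sigma> ^^ 2 ^ j) (gen_X j) = gen_X j"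
proof (induction j)
  case (Suc j)
  then show ?case
    using tower_endo.double_fixes_gen_X[OF funpow] by (simp only: funpow_double)
qed (simp add: rat gen_X_0)

lemma funpow_fixes_tower: "j \<le> n \<Longrightarrow> x \<in> tower j \<Longrightarrow> (\<sigma> ^^ 2 ^ j) x = x"
proof (induction j arbitrary: x)
  case (Suc j)
  interpret s: tower_endo n "\<sigma> ^^ 2 ^ Suc j" by (rule funpow)
  obtain a b where x: "a \<in> tower j" "b \<in> tower j" "x = a + b * gen_X (Suc j)"
    using Suc.prems(2) by (rule tower_SucE)
  have fixed: "(\<sigma> ^^ 2 ^ Suc j) c = c" if "c \<in> tower j" for c
    unfolding funpow_double using Suc.IH Suc.prems(1) that by simp
  have "a \<in> tower n" "b \<in> tower n" "gen_X (Suc j) \<in> tower n"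
    using x Suc.prems(1) by (auto intro: tower_mono[of j] tower_mono[OF _ gen_X_in_tower])
  then show ?case
    using funpow_fixes_gen_X[OF Suc.prems(1)] fixed[OF x(1)] fixed[OF x(2)]
    unfolding x(3) by (simp only: s.add s.mult tower_mult)
qed (simp add: rat)

text \<open>Used contrapositively: if the iterate belonging to the top level moves
  \<open>gen_X n\<close>, then the one belonging to each lower level moves its generator.\<close>

lemma gen_X_fixed_upwards:
  assumes "j \<le> i" "i < n" "(\<sigma> ^^ 2 ^ j) (gen_X (Suc j)) = gen_X (Suc j)"
  shows "(\<sigma> ^^ 2 ^ i) (gen_X (Suc i)) = gen_X (Suc i)"
  using assms
proof (induction rule: dec_induct)
  case (step i)
  then show ?case
    using tower_endo.double_fixes_gen_X[OF funpow] by (simp only: funpow_double)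
qed

text \<open>The relation \<open>gen_X (Suc j) ^ 2 = 2 + gen_X j\<close> passes to conjugates, and
  \<open>2 + 2 = 2 ^ 2\<close> keeps the bound.\<close>

lemma abs_conjugate_gen_X_le: "j \<le> n \<Longrightarrow> \<bar>(\<sigma> ^^ i) (gen_X j)\<bar> \<le> 2"
proof (induction j)
  case 0
  interpret s: tower_endo n "\<sigma> ^^ i" by (rule funpow)
  show ?case by (simp add: gen_X_0 s.rat)
next
  case (Suc j)
  interpret s: tower_endo n "\<sigma> ^^ i" by (rule funpow)
  have t: "gen_X (Suc j) \<in> tower n" "gen_X j \<in> tower n"
    using Suc.prems by (auto intro: tower_mono[OF _ gen_X_in_tower])
  have "((\<sigma> ^^ i) (gen_X (Suc j)))\<^sup>2 = 2 + (\<sigma> ^^ i) (gen_X j)"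
    using t by (simp add: s.power[symmetric] gen_X_Suc_sq s.add s.rat Rats_subset_tower)
  also have "\<dots> \<le> 2\<^sup>2" using Suc by simp
  finally show ?case by (metis abs_le_square_iff abs_numeral)
qed

end

text \<open>Full order of \<open>\<sigma>\<close>, expressed on generators:
  \<open>\<sigma> ^^ 2 ^ j\<close>, which fixes \<open>tower j\<close>, acts on the next quadratic
  step as its nontrivial conjugation.\<close>

locale tower_flip = tower_endo +
  assumes flip: "j < n \<Longrightarrow> (\<sigma> ^^ 2 ^ j) (gen_X (Suc j)) = - gen_X (Suc j)"
begin

text \<open>The relative norm of \<open>1 + gen_X (Suc j)\<close> is
  \<open>1 - gen_X (Suc j) ^ 2 = - (1 + gen_X j)\<close>; pairing the factors \<open>i\<close> and
  \<open>i + 2 ^ j\<close> reduces the product to the level below.\<close>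

lemma prod_conjugates:
  "j \<le> n \<Longrightarrow> (\<Prod>i<2 ^ j. (\<sigma> ^^ i) (1 + gen_X j)) = (if j = 0 then 1 else - 1)"
proof (induction j)
  case (Suc j)
  define g where "g = (\<lambda>i. (\<sigma> ^^ i) (1 + gen_X (Suc j)))"
  have t: "gen_X (Suc j) \<in> tower n" "gen_X j \<in> tower n"
    using Suc.prems by (auto intro: tower_mono[OF _ gen_X_in_tower])
  have g: "g i * g (i + 2 ^ j) = - (\<sigma> ^^ i) (1 + gen_X j)" for i
  proof -
    interpret s: tower_endo n "\<sigma> ^^ i" by (rule funpow)
    interpret u: tower_endo n "\<sigma> ^^ 2 ^ j" by (rule funpow)
    have "(\<sigma> ^^ 2 ^ j) (1 + gen_X (Suc j)) = 1 - gen_X (Suc j)"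
      using t flip[of j] Suc.prems by (simp add: u.add u.rat Rats_subset_tower)
    then have "g i * g (i + 2 ^ j) = (\<sigma> ^^ i) ((1 + gen_X (Suc j)) * (1 - gen_X (Suc j)))"
      using t by (simp add: g_def funpow_add s.mult tower_add tower_diff Rats_subset_tower)
    also have "(1 + gen_X (Suc j)) * (1 - gen_X (Suc j)) = - (1 + gen_X j)"
      using gen_X_Suc_sq[of j] by (simp add: algebra_simps power2_eq_square)
    finally show ?thesis using t by (simp only: s.minus tower_add Rats_subset_tower Rats_1)
  qed
  have "(\<Prod>i<2 ^ Suc j. g i) = (\<Prod>i<2 ^ j + 2 ^ j. g i)" by (simp add: mult_2)
  also have "\<dots> = (\<Prod>i<2 ^ j. g i * g (i + 2 ^ j))"
    by (simp add: prod.distrib lessThan_atLeast0 prod.nat_group[symmetric]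
        prod.atLeastLessThan_concat[of 0 "2 ^ j" "2 ^ j + 2 ^ j", symmetric]
        prod.shift_bounds_nat_ivl[of _ 0 "2 ^ j" "2 ^ j", simplified])
  also have "\<dots> = (- 1) ^ (2 ^ j) * (\<Prod>i<2 ^ j. (\<sigma> ^^ i) (1 + gen_X j))"
    by (simp add: g prod_uminus)
  \<comment> \<open>For \<open>j = 0\<close> the sign comes from the single factor
    \<open>- 1\<close>; for larger \<open>j\<close> the exponent is even and the sign comes from the
    induction hypothesis.\<close>
  also have "\<dots> = - 1" using Suc by (cases "j = 0") auto
  finally show ?case by (simp add: g_def)
qed (simp add: gen_X_0)

text \<open>With \<open>s = \<sigma>\<close> to the power \<open>2\<^sup>j\<close>, the pair \<open>x + s x\<close>, \<open>(x - s x) X\<^sub>j\<^sub>+\<^sub>1\<close> determines \<open>x\<close> and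
  lies one level lower in the tower.\<close>

lemma finite_bounded_conjugates:
  "j \<le> n \<Longrightarrow> finite {x \<in> tower j. algebraic_int x \<and> (\<forall>i. \<bar>(\<sigma> ^^ i) x\<bar> \<le> M)}"
proof (induction j arbitrary: M)
  case 0
  \<comment> \<open>Rational algebraic integers are integers; the bound is used for the zeroth
    iterate.\<close>
  have "{x \<in> tower 0. algebraic_int x \<and> (\<forall>i. \<bar>(\<sigma> ^^ i) x\<bar> \<le> M)} \<subseteq> {x \<in> \<int>. \<bar>x\<bar> \<le> M}"
    using rational_algebraic_int_is_int by (auto dest: spec[of _ 0])
  then show ?case by (rule finite_subset) (rule finite_abs_int_segment)
next
  case (Suc j)
  let ?F = "\<lambda>j M. {x \<in> tower j. algebraic_int x \<and> (\<forall>i. \<bar>(\<sigma> ^^ i) x\<bar> \<le> M)}"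
  let ?X = "gen_X (Suc j)"
  define s where "s = \<sigma> ^^ 2 ^ j"
  interpret s: tower_endo n s unfolding s_def by (rule funpow)
  \<comment> \<open>Multiplying the difference by \<open>?X\<close>, instead of dividing, moves it
    to \<open>tower j\<close> while keeping it an algebraic integer.\<close>
  define h where "h = (\<lambda>x. (x + s x, (x - s x) * ?X))"
  have X: "?X \<in> tower n" using Suc.prems by (rule tower_mono[OF _ gen_X_in_tower])
  have "inj h"
    by (rule injI) (auto simp: h_def gen_X_Suc_neq_0)
  moreover have "h x \<in> ?F j (2 * M) \<times> ?F j (4 * M)" if "x \<in> ?F (Suc j) M" for x
  proof -
    have x: "x \<in> tower (Suc j)" "algebraic_int x" "\<bar>(\<sigma> ^^ i) x\<bar> \<le> M" for i using that by auto
    have xn: "x \<in> tower n" using x(1) Suc.prems by (rule tower_mono[rotated])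
    obtain a b where ab: "a \<in> tower j" "b \<in> tower j" "x = a + b * ?X"
      using x(1) by (rule tower_SucE)
    have abn: "a \<in> tower n" "b \<in> tower n"
      using ab Suc.prems by (auto intro: tower_mono[of j])
    have sx: "s x = a - b * ?X"
    proof -
      have "s a = a" "s b = b" "s ?X = - ?X"
        using ab Suc.prems flip by (auto simp: s_def funpow_fixes_tower)
      then show ?thesis using abn X by (simp add: ab(3) s.add s.mult tower_mult)
    qed
    have sn: "s x \<in> tower n" using xn by (rule s.closed)
    have as: "algebraic_int (s x)" using xn x(2) by (rule s.algebraic_int)
    have "x + s x = 2 * a" using sx ab(3) by simp
    then have 1: "x + s x \<in> tower j" using ab(1) by (simp add: tower_mult Rats_subset_tower)
    have "x - s x = 2 * b * ?X" using sx ab(3) by simp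
    then have "(x - s x) * ?X = 2 * b * (2 + gen_X j)"
      unfolding gen_X_Suc_sq[symmetric] by (simp add: power2_eq_square)
    then have 2: "(x - s x) * ?X \<in> tower j"
      using ab(2) by (simp add: tower_mult tower_add Rats_subset_tower gen_X_in_tower)
    have bound: "\<bar>(\<sigma> ^^ i) (x + s x)\<bar> \<le> 2 * M" "\<bar>(\<sigma> ^^ i) ((x - s x) * ?X)\<bar> \<le> 4 * M" for i
    proof -
      interpret u: tower_endo n "\<sigma> ^^ i" by (rule funpow)
      have b: "\<bar>(\<sigma> ^^ i) x\<bar> \<le> M" "\<bar>(\<sigma> ^^ i) (s x)\<bar> \<le> M"
        using x(3)[of i] x(3)[of "i + 2 ^ j"] by (auto simp: s_def funpow_add)
      then show "\<bar>(\<sigma> ^^ i) (x + s x)\<bar> \<le> 2 * M" using xn sn by (simp add: u.add)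
      have "\<bar>(\<sigma> ^^ i) x - (\<sigma> ^^ i) (s x)\<bar> \<le> 2 * M" using b by linarith
      then have "\<bar>(\<sigma> ^^ i) x - (\<sigma> ^^ i) (s x)\<bar> * \<bar>(\<sigma> ^^ i) ?X\<bar> \<le> (2 * M) * 2"
        using abs_conjugate_gen_X_le[OF Suc.prems, of i] b by (intro mult_mono) auto
      then show "\<bar>(\<sigma> ^^ i) ((x - s x) * ?X)\<bar> \<le> 4 * M"
        using xn sn X by (simp add: u.mult u.diff tower_diff abs_mult)
    qed
    show ?thesis
      using 1 2 bound x(2) as
      by (auto simp: h_def intro!: algebraic_int_plus algebraic_int_times algebraic_int_diff algebraic_int_gen_X)
  qed
  then have "h ` ?F (Suc j) M \<subseteq> ?F j (2 * M) \<times> ?F j (4 * M)" by blast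
  moreover have "finite (?F j (2 * M) \<times> ?F j (4 * M))"
    using Suc by (intro finite_cartesian_product) auto
  ultimately show ?case
    by (meson finite_imageD finite_subset inj_on_subset subset_UNIV)
qed

end

section \<open>Signatures of circular units\<close>

lemma power_int_less_0_iff:
  fixes e :: real
  assumes "e \<noteq> 0"
  shows "e powi k < 0 \<longleftrightarrow> e < 0 \<and> odd k"
proof (cases "even k")
  case True
  then obtain m where "k = m + m" by (metis dvdE mult_2)
  then have "e powi k = e powi m * e powi m" using assms by (metis power_int_add)
  then show ?thesis using True by (simp add: not_less)
next
  case False
  then obtain m where "k = (m + m) + 1" by (metis oddE mult_2)
  then have "e powi k = (e powi m * e powi m) * e"
    using assms by (metis power_int_add power_int_1_right)
  moreover have "e powi m * e powi m > 0"
    using assms by (metis not_real_square_gt_zero power_int_eq_0_iff)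
  ultimately show ?thesis using False by (simp add: mult_less_0_iff)
qed

text \<open>Negativity is read as a homomorphism to the field with two elements, on which exponents
  act through their parity.\<close>

lemma prod_power_int_less_0_iff:
  fixes e :: "'i \<Rightarrow> real"
  assumes "finite I" "\<And>i. i \<in> I \<Longrightarrow> e i \<noteq> 0"
  shows "(\<Prod>i\<in>I. e i powi a i) < 0 \<longleftrightarrow>
    (\<Sum>i\<in>I. of_bool (odd (a i)) * of_bool (e i < 0)) = (1 :: bit)"
  using assms
proof (induction I)
  case (insert i I)
  have nz: "(\<Prod>i\<in>I. e i powi a i) \<noteq> 0" "e i powi a i \<noteq> 0"
    using insert by (auto simp: power_int_eq_0_iff)
  have "p * q < 0 \<longleftrightarrow> (p < 0) \<noteq> (q < 0)" if "p \<noteq> 0" "q \<noteq> 0" for p q :: real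
    using that by (auto simp: mult_less_0_iff neq_iff)
  then have "(\<Prod>i\<in>insert i I. e i powi a i) < 0 \<longleftrightarrow>
      ((e i powi a i < 0) \<noteq> ((\<Prod>i\<in>I. e i powi a i) < 0))"
    using insert.hyps nz by simp
  moreover have "e i powi a i < 0 \<longleftrightarrow> e i < 0 \<and> odd (a i)"
    using insert by (intro power_int_less_0_iff) auto
  ultimately show ?case
    using insert by (cases "(\<Sum>i\<in>I. of_bool (odd (a i)) * of_bool (e i < 0)) = (1 :: bit)") auto
qed simp

section \<open>Exponent vectors of circular units\<close>

context tower_flip
begin

definition conj_unit :: "nat \<Rightarrow> real" where
  "conj_unit i = (\<sigma> ^^ i) (1 + gen_X n)"

text \<open>The vector \<open>a\<close> plays the role of an element of the group ring of
  \<open>G_n\<close> over the integers acting on \<open>1 + gen_X n\<close>; only the entries below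
  \<open>2 ^ n\<close> count.\<close>

definition circ :: "(nat \<Rightarrow> int) \<Rightarrow> real" where
  "circ a = (\<Prod>i<2 ^ n. conj_unit i powi a i)"

lemma conj_unit_unit: "conj_unit i \<in> carrier (units_E n)"
  unfolding conj_unit_def by (intro tower_endo.unit[OF funpow] one_plus_gen_X_unit)

lemma conj_unit_tower: "conj_unit i \<in> tower n"
  and conj_unit_neq_0: "conj_unit i \<noteq> 0"
  using conj_unit_unit[of i] by (auto simp: carrier_units_E)

lemma funpow_conj_unit: "(\<sigma> ^^ j) (conj_unit i) = conj_unit (i + j)"
  by (simp add: conj_unit_def funpow_add add.commute[of i])

lemma conj_unit_periodic: "conj_unit (i + 2 ^ n) = conj_unit i"
  using funpow_conj_unit[of "2 ^ n" i] conj_unit_tower by (simp add: funpow_fixes_tower)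

lemma conj_unit_mod: "conj_unit (i mod 2 ^ n) = conj_unit i"
proof -
  have "conj_unit (j + 2 ^ n * k) = conj_unit j" for j k
  proof (induction k)
    case (Suc k)
    have "j + 2 ^ n * Suc k = (j + 2 ^ n * k) + 2 ^ n" by simp
    then show ?case using Suc conj_unit_periodic by metis
  qed simp
  then show ?thesis by (metis mod_mult_div_eq)
qed

lemma abs_conj_unit_le: "\<bar>conj_unit i\<bar> \<le> 3"
proof -
  interpret s: tower_endo n "\<sigma> ^^ i" by (rule funpow)
  have "conj_unit i = 1 + (\<sigma> ^^ i) (gen_X n)"
    by (simp add: conj_unit_def s.add s.rat gen_X_in_tower Rats_subset_tower)
  then show ?thesis using abs_conjugate_gen_X_le[of n i] by simp
qed

lemma circ_tower: "circ a \<in> tower n"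
  unfolding circ_def by (intro tower_prod tower_power_int conj_unit_tower)

lemma circ_neq_0: "circ a \<noteq> 0"
  unfolding circ_def by (simp add: power_int_eq_0_iff conj_unit_neq_0)

lemma circ_add: "circ (\<lambda>i. a i + b i) = circ a * circ b"
  unfolding circ_def by (simp add: power_int_add conj_unit_neq_0 prod.distrib)

lemma circ_uminus: "circ (\<lambda>i. - a i) = inverse (circ a)"
  unfolding circ_def by (simp add: power_int_minus prod_inversef[symmetric] o_def)

lemma circ_0: "circ (\<lambda>i. 0) = 1"
  unfolding circ_def by simp

lemma circ_mult: "circ (\<lambda>i. int m * a i) = circ a ^ m"
  by (induction m) (simp_all add: circ_0 distrib_right circ_add)

lemma conj_unit_eq_circ: "conj_unit i = circ (\<lambda>k. if k = i mod 2 ^ n then 1 else 0)"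
proof -
  have "circ (\<lambda>k. if k = i mod 2 ^ n then 1 else 0)
      = (\<Prod>k<2 ^ n. if k = i mod 2 ^ n then conj_unit k else 1)"
    unfolding circ_def by (intro prod.cong refl) auto
  also have "\<dots> = conj_unit (i mod 2 ^ n)" by simp
  finally show ?thesis by (simp add: conj_unit_mod)
qed

text \<open>The norm of \<open>1 + gen_X n\<close> is -1, so signs are absorbed into
  \<open>range circ\<close>.\<close>

lemma circ_1: "n \<ge> 1 \<Longrightarrow> circ (\<lambda>i. 1) = - 1"
  using prod_conjugates[of n] by (simp add: circ_def conj_unit_def)

lemma funpow_circ: "(\<sigma> ^^ j) (circ a) = (\<Prod>i<2 ^ n. conj_unit (i + j) powi a i)"
proof -
  interpret s: tower_endo n "\<sigma> ^^ j" by (rule funpow)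
  show ?thesis
    unfolding circ_def
    by (simp add: s.prod s.power_int tower_power_int conj_unit_tower funpow_conj_unit)
qed

text \<open>The sign of the \<open>j\<close>-th conjugate of \<open>circ a\<close> is the cyclic
  convolution at \<open>j\<close> of \<open>a\<close> modulo 2 with the signs of the conjugates of
  \<open>1 + gen_X n\<close>. Total positivity makes it vanish everywhere.\<close>

lemma circ_totally_positive_even:
  assumes "n \<ge> 1" and pos: "\<And>j. (\<sigma> ^^ j) (circ a) > 0" and "i < 2 ^ n"
  shows "even (a i)"
proof -
  define f :: "nat \<Rightarrow> bit" where "f = (\<lambda>i. of_bool (conj_unit i < 0))"
  define b :: "nat \<Rightarrow> bit" where "b = (\<lambda>i. of_bool (odd (a i)))"
  have "b i = 0"
  proof (rule cyclic_convolution_eq_0_imp)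
    show "f (i + 2 ^ n) = f i" for i by (simp add: f_def conj_unit_periodic)
    \<comment> \<open>The product of all conjugates is -1, so an odd number of them is
      negative.\<close>
    show "(\<Sum>i<2 ^ n. f i) = 1"
      using circ_1[OF assms(1)]
        prod_power_int_less_0_iff[of "{..<2 ^ n}" conj_unit "\<lambda>_. 1"] conj_unit_neq_0
      by (simp add: f_def circ_def)
    show "(\<Sum>i<2 ^ n. b i * f (i + j)) = 0" for j
    proof -
      have "(\<sigma> ^^ j) (circ a) < 0 \<longleftrightarrow> (\<Sum>i<2 ^ n. b i * f (i + j)) = 1"
        unfolding funpow_circ f_def b_def
        by (rule prod_power_int_less_0_iff) (auto simp: conj_unit_neq_0)
      then have "(\<Sum>i<2 ^ n. b i * f (i + j)) \<noteq> 1" using pos[of j] by (meson less_asym)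
      then show ?thesis by (simp only: bit_not_one_iff)
    qed
  qed fact
  then show ?thesis by (simp add: b_def split: if_splits)
qed

text \<open>All conjugates of a nonzero square are positive, so the exponents are even and can be
  halved; the remaining sign is itself a value of \<open>circ\<close>.\<close>

lemma sqrt_of_circ:
  assumes "n \<ge> 1" "u \<in> tower n" "u \<noteq> 0" "u\<^sup>2 = circ a"
  shows "u \<in> range circ"
proof -
  have "(\<sigma> ^^ j) (circ a) > 0" for j
  proof -
    interpret s: tower_endo n "\<sigma> ^^ j" by (rule funpow)
    have "(\<sigma> ^^ j) u \<noteq> 0" using assms by (intro s.neq_0)
    then show ?thesis using assms by (simp add: assms(4)[symmetric] s.power)
  qed
  then have ev: "even (a i)" if "i < 2 ^ n" for i
    using circ_totally_positive_even assms(1) that by blast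
  define b where "b = (\<lambda>i. a i div 2)"
  have "circ a = circ (\<lambda>i. int 2 * b i)"
    unfolding circ_def b_def using ev by (intro prod.cong refl) auto
  also have "\<dots> = (circ b)\<^sup>2" by (rule circ_mult)
  finally have "u\<^sup>2 = (circ b)\<^sup>2" using assms(4) by simp
  then have "u = circ b \<or> u = - circ b" by (simp add: power2_eq_iff)
  moreover have "- circ b = circ (\<lambda>i. 1 + b i)"
    using circ_add[of "\<lambda>_. 1" b] circ_1[OF assms(1)] by simp
  ultimately show ?thesis by auto
qed

text \<open>Reducing the exponents modulo \<open>m\<close> moves \<open>u\<close> by a circular unit to an element
  whose \<open>m\<close>-th power has conjugates bounded by the \<open>m\<close>-th power of a constant.\<close>

lemma root_of_circ_bounded:
  assumes "u \<in> tower n" "m > 0" "u ^ m = circ a"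
  obtains b where "\<And>j. \<bar>(\<sigma> ^^ j) (u * circ b)\<bar> \<le> 3 ^ (2 ^ n)"
proof
  define b where "b = (\<lambda>i. - (a i div int m))"
  fix j
  interpret s: tower_endo n "\<sigma> ^^ j" by (rule funpow)
  have "(u * circ b) ^ m = circ (\<lambda>i. a i + int m * b i)"
    by (simp add: power_mult_distrib assms(3) circ_add circ_mult)
  also have "\<dots> = circ (\<lambda>i. a i mod int m)"
    by (simp add: b_def minus_mult_div_eq_mod)
  finally have eq: "(u * circ b) ^ m = circ (\<lambda>i. a i mod int m)" .
  have "\<bar>(\<sigma> ^^ j) (u * circ b)\<bar> ^ m = \<bar>(\<sigma> ^^ j) ((u * circ b) ^ m)\<bar>"
    using assms(1) by (simp add: s.power tower_mult circ_tower power_abs)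
  also have "\<dots> = (\<Prod>i<2 ^ n. \<bar>conj_unit (i + j)\<bar> ^ nat (a i mod int m))"
    unfolding eq funpow_circ abs_prod
    using assms(2) by (intro prod.cong refl) (simp add: power_int_def power_abs)
  also have "\<dots> \<le> (\<Prod>i<(2::nat) ^ n. 3 ^ m)"
  proof (rule prod_mono, safe)
    fix i
    have "\<bar>conj_unit (i + j)\<bar> ^ nat (a i mod int m) \<le> 3 ^ nat (a i mod int m)"
      by (intro power_mono abs_conj_unit_le) auto
    also have "nat (a i mod int m) \<le> m" using assms(2) by (simp add: nat_le_iff less_imp_le)
    then have "(3 :: real) ^ nat (a i mod int m) \<le> 3 ^ m" by (intro power_increasing) auto
    finally show "\<bar>conj_unit (i + j)\<bar> ^ nat (a i mod int m) \<le> 3 ^ m" .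
  qed auto
  also have "\<dots> = (3 ^ (2 ^ n)) ^ m" by (simp add: power_mult[symmetric] mult.commute)
  finally show "\<bar>(\<sigma> ^^ j) (u * circ b)\<bar> \<le> 3 ^ (2 ^ n)"
    using assms(2) by (simp add: power_mono_iff)
qed

end

section \<open>The Galois group\<close>

lemma tower_endo_cong:
  assumes "tower_endo n \<rho>" "\<And>x. x \<in> tower n \<Longrightarrow> \<tau> x = \<rho> x"
  shows "tower_endo n \<tau>"
proof -
  interpret tower_endo n \<rho> by fact
  show ?thesis
    by unfold_locales
      (simp_all add: assms(2) closed add mult rat tower_add tower_mult Rats_subset_tower)
qed

lemma gal_G_iff: "\<tau> \<in> carrier (gal_G n) \<longleftrightarrow> tower_endo n \<tau> \<and> \<tau> \<in> Bij (tower n)"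
  unfolding gal_G_def gal_group_def Ring.ring_hom_def tower_endo_def
  by (auto simp: carrier_field_B field_B_simps Rats_subset_tower Pi_iff)

lemma gal_G_simps:
  "\<tau> \<in> Bij (tower n) \<Longrightarrow> \<rho> \<in> Bij (tower n) \<Longrightarrow> \<tau> \<otimes>\<^bsub>gal_G n\<^esub> \<rho> = compose (tower n) \<tau> \<rho>"
  "\<one>\<^bsub>gal_G n\<^esub> = (\<lambda>x\<in>tower n. x)"
  by (auto simp: gal_G_def gal_group_def BijGroup_def carrier_field_B)

lemma gal_G_pow:
  assumes "\<sigma> \<in> carrier (gal_G n)"
  shows "\<sigma> [^]\<^bsub>gal_G n\<^esub> (k :: nat) \<in> carrier (gal_G n) \<and>
    (\<forall>x\<in>tower n. (\<sigma> [^]\<^bsub>gal_G n\<^esub> k) x = (\<sigma> ^^ k) x)"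
proof -
  interpret tower_endo n \<sigma> using assms by (simp add: gal_G_iff)
  have "\<sigma> [^]\<^bsub>gal_G n\<^esub> k \<in> Bij (tower n) \<and>
    (\<forall>x\<in>tower n. (\<sigma> [^]\<^bsub>gal_G n\<^esub> k) x = (\<sigma> ^^ k) x)"
  proof (induction k)
    case 0
    show ?case
      using id_Bij[of "tower n"] by (simp add: gal_G_simps restrict_def)
  next
    case (Suc k)
    then show ?case using assms closed
      by (auto simp: gal_G_simps gal_G_iff compose_Bij compose_eq funpow_swap1)
  qed
  moreover have "tower_endo n (\<sigma> ^^ k)" by (rule funpow)
  ultimately show ?thesis
    unfolding gal_G_iff by (auto intro: tower_endo_cong)
qed

text \<open>Uniqueness of the inverse is borrowed from the group of all bijections of
  \<open>tower n\<close>, which has the same product and unit. The exponent \<open>2 ^ n - 1\<close>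
  works because \<open>2 ^ n\<close> iterations of \<open>\<sigma>\<close> fix
  \<open>tower n\<close>.\<close>

lemma gal_G_inv:
  assumes "\<sigma> \<in> carrier (gal_G n)"
  shows "inv\<^bsub>gal_G n\<^esub> \<sigma> = \<sigma> [^]\<^bsub>gal_G n\<^esub> (2 ^ n - 1 :: nat)"
proof -
  interpret tower_endo n \<sigma> using assms by (simp add: gal_G_iff)
  interpret B: group "BijGroup (tower n)" by (rule group_BijGroup)
  have B: "carrier (gal_G n) \<subseteq> carrier (BijGroup (tower n))"
    by (auto simp: gal_G_iff BijGroup_def)
  have mult: "monoid.mult (gal_G n) = monoid.mult (BijGroup (tower n))"
    "\<one>\<^bsub>gal_G n\<^esub> = \<one>\<^bsub>BijGroup (tower n)\<^esub>"
    by (auto simp: gal_G_def gal_group_def BijGroup_def carrier_field_B)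
  define \<rho> where "\<rho> = \<sigma> [^]\<^bsub>gal_G n\<^esub> (2 ^ n - 1 :: nat)"
  have \<rho>: "\<rho> \<in> carrier (gal_G n)" "\<And>x. x \<in> tower n \<Longrightarrow> \<rho> x = (\<sigma> ^^ (2 ^ n - 1)) x"
    using gal_G_pow[OF assms] by (auto simp: \<rho>_def)
  have "\<rho> \<otimes>\<^bsub>gal_G n\<^esub> \<sigma> = \<one>\<^bsub>gal_G n\<^esub>"
  proof -
    have "(\<sigma> ^^ (2 ^ n - 1)) (\<sigma> x) = x" if "x \<in> tower n" for x
      using funpow_fixes_tower[OF order_refl that]
      by (metis One_nat_def Suc_pred comp_apply funpow_Suc_right pos2 zero_less_power)
    then show ?thesis
      using \<rho> assms closed by (auto simp: gal_G_simps gal_G_iff compose_def fun_eq_iff)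
  qed
  then have l: "\<rho> \<otimes>\<^bsub>BijGroup (tower n)\<^esub> \<sigma> = \<one>\<^bsub>BijGroup (tower n)\<^esub>" by (simp add: mult)
  have binv: "inv\<^bsub>BijGroup (tower n)\<^esub> \<sigma> = \<rho>"
    using l assms \<rho>(1) B by (intro B.inv_equality) auto
  then have r: "\<sigma> \<otimes>\<^bsub>BijGroup (tower n)\<^esub> \<rho> = \<one>\<^bsub>BijGroup (tower n)\<^esub>"
    using assms B B.r_inv by blast
  show ?thesis
    unfolding m_inv_def mult \<rho>_def[symmetric]
  proof (rule the_equality)
    fix y assume "y \<in> carrier (gal_G n) \<and> \<sigma> \<otimes>\<^bsub>BijGroup (tower n)\<^esub> y = \<one>\<^bsub>BijGroup (tower n)\<^esub> \<and>
      y \<otimes>\<^bsub>BijGroup (tower n)\<^esub> \<sigma> = \<one>\<^bsub>BijGroup (tower n)\<^esub>"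
    then show "y = \<rho>" using B.inv_equality[of y \<sigma>] binv assms B by auto
  qed (use l r \<rho> in auto)
qed

text \<open>Inverses of \<open>\<sigma>\<close> being nonnegative powers, plain iterates exhaust the
  group on \<open>tower n\<close>.\<close>

lemma gal_G_generator:
  assumes \<sigma>: "\<sigma> \<in> carrier (gal_G n)" and gen: "generate (gal_G n) {\<sigma>} = carrier (gal_G n)"
    and "\<tau> \<in> carrier (gal_G n)"
  shows "\<exists>k. \<forall>x\<in>tower n. \<tau> x = (\<sigma> ^^ k) x"
proof -
  interpret tower_endo n \<sigma> using \<sigma> by (simp add: gal_G_iff)
  have sub: "\<rho> \<in> carrier (gal_G n)" if "\<rho> \<in> generate (gal_G n) {\<sigma>}" for \<rho>
    using that gen by simp
  have "\<tau> \<in> generate (gal_G n) {\<sigma>}" using assms by simp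
  then show ?thesis
  proof induction
    case one
    show ?case by (intro exI[of _ 0]) (simp add: gal_G_simps)
  next
    case (incl h)
    then show ?case by (intro exI[of _ 1]) simp
  next
    case (inv h)
    then show ?case using gal_G_pow[OF \<sigma>] gal_G_inv[OF \<sigma>] by auto
  next
    case (eng h1 h2)
    then obtain i j where ij: "\<forall>x\<in>tower n. h1 x = (\<sigma> ^^ i) x" "\<forall>x\<in>tower n. h2 x = (\<sigma> ^^ j) x"
      by blast
    have h: "h1 \<in> Bij (tower n)" "h2 \<in> Bij (tower n)" using sub[OF eng(1)] sub[OF eng(2)] by (auto simp: gal_G_iff)
    interpret s: tower_endo n "\<sigma> ^^ j" by (rule funpow)
    show ?case
      using ij s.closed by (intro exI[of _ "i + j"]) (simp add: gal_G_simps h compose_eq funpow_add)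
  qed
qed

section \<open>The groups \<open>RE_n^+\<close> and \<open>C_n\<close>\<close>

lemma minus_1_unit: "- 1 \<in> carrier (units_E n)"
  by (simp add: carrier_units_E Rats_subset_tower)

lemma RE_plus_iff:
  assumes "\<sigma> \<in> carrier (gal_G n)"
  shows "x \<in> RE_plus \<sigma> n \<longleftrightarrow> x \<in> carrier (units_E n) \<and> x * (\<sigma> ^^ 2 ^ (n - 1)) x = 1"
  using gal_G_pow[OF assms, of "2 ^ (n - 1)"]
  by (auto simp: RE_plus_def kernel_def relnorm_def units_E_simps carrier_units_E)

lemma subgroup_RE_plus:
  assumes "\<sigma> \<in> carrier (gal_G n)"
  shows "subgroup (RE_plus \<sigma> n) (units_E n)"
proof -
  interpret E: comm_group "units_E n" by (rule comm_group_units_E)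
  interpret tower_endo n \<sigma> using assms by (simp add: gal_G_iff)
  interpret s: tower_endo n "\<sigma> ^^ 2 ^ (n - 1)" by (rule funpow)
  have T: "x \<in> tower n" if "x \<in> carrier (units_E n)" for x using that by (simp add: carrier_units_E)
  show ?thesis
  proof (rule E.subgroupI)
    show "RE_plus \<sigma> n \<subseteq> carrier (units_E n)" by (auto simp: RE_plus_iff[OF assms])
    have "1 \<in> RE_plus \<sigma> n"
      using E.one_closed by (simp add: RE_plus_iff[OF assms] units_E_simps s.rat del: One_nat_def)
    then show "RE_plus \<sigma> n \<noteq> {}" by blast
  next
    fix x assume "x \<in> RE_plus \<sigma> n"
    then have x: "x \<in> carrier (units_E n)" "x * (\<sigma> ^^ 2 ^ (n - 1)) x = 1"
      by (auto simp: RE_plus_iff[OF assms])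
    have "inverse x * inverse ((\<sigma> ^^ 2 ^ (n - 1)) x) = 1"
      using x(2) by (metis inverse_1 inverse_mult_distrib)
    then show "inv\<^bsub>units_E n\<^esub> x \<in> RE_plus \<sigma> n"
      using x(1) T by (simp add: RE_plus_iff[OF assms] inv_units_E units_E_inverse s.inverse del: One_nat_def)
  next
    fix x y assume "x \<in> RE_plus \<sigma> n" "y \<in> RE_plus \<sigma> n"
    then have xy: "x \<in> carrier (units_E n)" "x * (\<sigma> ^^ 2 ^ (n - 1)) x = 1"
      "y \<in> carrier (units_E n)" "y * (\<sigma> ^^ 2 ^ (n - 1)) y = 1"
      by (auto simp: RE_plus_iff[OF assms])
    have "x * y * ((\<sigma> ^^ 2 ^ (n - 1)) x * (\<sigma> ^^ 2 ^ (n - 1)) y)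
        = (x * (\<sigma> ^^ 2 ^ (n - 1)) x) * (y * (\<sigma> ^^ 2 ^ (n - 1)) y)" by (simp only: mult_ac)
    then show "x \<otimes>\<^bsub>units_E n\<^esub> y \<in> RE_plus \<sigma> n"
      using xy T by (simp add: RE_plus_iff[OF assms] units_E_simps units_E_mult s.mult del: One_nat_def)
  qed
qed

lemma subgroup_circ_C: "subgroup (circ_C n) (units_E n)"
proof -
  interpret E: comm_group "units_E n" by (rule comm_group_units_E)
  show ?thesis
    unfolding circ_C_def galois_span_def
    using one_plus_gen_X_unit[of n] minus_1_unit[of n]
    by (intro E.generate_is_subgroup) (auto simp: gal_G_iff tower_endo.unit)
qed

lemma conjugates_in_circ_C:
  assumes "\<tau> \<in> carrier (gal_G n)"
  shows "\<tau> (1 + gen_X n) \<in> circ_C n" and "- 1 \<in> circ_C n"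
proof -
  show "\<tau> (1 + gen_X n) \<in> circ_C n"
    unfolding circ_C_def galois_span_def using assms by (intro generate.incl) blast
  interpret tower_endo n \<tau> using assms by (simp add: gal_G_iff)
  have "\<tau> (- 1) = - 1" by (simp add: rat)
  then show "- 1 \<in> circ_C n"
    unfolding circ_C_def galois_span_def using assms
    by (intro generate.incl) (metis (mono_tags, lifting) CollectI insertI1)
qed

context tower_flip
begin

lemma range_circ_mult: "x \<in> range circ \<Longrightarrow> y \<in> range circ \<Longrightarrow> x * y \<in> range circ"
  by (auto simp: circ_add[symmetric])

lemma range_circ_inverse: "x \<in> range circ \<Longrightarrow> inverse x \<in> range circ"
  by (auto simp: circ_uminus[symmetric])

text \<open>Up to restriction every automorphism is an iterate of \<open>\<sigma>\<close>, so the
  generators of \<open>C_n\<close> are the \<open>conj_unit k\<close> and -1, all of them values of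
  \<open>circ\<close>.\<close>

lemma circ_C_eq:
  assumes "n \<ge> 1" and \<sigma>: "\<sigma> \<in> carrier (gal_G n)"
    and gen: "generate (gal_G n) {\<sigma>} = carrier (gal_G n)"
  shows "circ_C n = range circ"
proof (intro equalityI subsetI)
  let ?S = "{\<tau> u | \<tau> u. \<tau> \<in> carrier (gal_G n) \<and> u \<in> {- 1, 1 + gen_X n}}"
  have S: "x \<in> range circ \<and> x \<in> carrier (units_E n)" if "x \<in> ?S" for x
  proof -
    obtain \<tau> u where x: "x = \<tau> u" "\<tau> \<in> carrier (gal_G n)" "u = - 1 \<or> u = 1 + gen_X n"
      using \<open>x \<in> ?S\<close> by blast
    interpret t: tower_endo n \<tau> using x(2) by (simp add: gal_G_iff)
    obtain k where k: "\<And>x. x \<in> tower n \<Longrightarrow> \<tau> x = (\<sigma> ^^ k) x"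
      using gal_G_generator[OF \<sigma> gen x(2)] by blast
    show ?thesis
    proof (cases "u = - 1")
      case True
      then have "x = - 1" by (simp add: x(1) t.rat)
      then show ?thesis using circ_1[OF assms(1)] minus_1_unit by (metis rangeI)
    next
      case False
      then have "x = conj_unit k"
        using x k by (simp add: conj_unit_def tower_add gen_X_in_tower Rats_subset_tower)
      then show ?thesis using conj_unit_eq_circ[of k] conj_unit_unit by blast
    qed
  qed
  fix x assume "x \<in> circ_C n"
  then have "x \<in> generate (units_E n) ?S" by (simp add: circ_C_def galois_span_def)
  then show "x \<in> range circ"
  proof induction
    case one
    then show ?case using circ_0 by (auto simp: units_E_simps intro: range_eqI[of _ _ "\<lambda>_. 0"])
  next
    case (incl h)
    then show ?case using S by blast
  next
    case (inv h)
    then show ?case using S[OF inv] by (auto simp: inv_units_E intro: range_circ_inverse)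
  next
    case (eng h1 h2)
    then show ?case by (simp add: units_E_simps range_circ_mult)
  qed
next
  interpret E: comm_group "units_E n" by (rule comm_group_units_E)
  interpret C: subgroup "circ_C n" "units_E n" by (rule subgroup_circ_C)
  have inverse: "inverse x \<in> circ_C n" if "x \<in> circ_C n" for x
    using C.m_inv_closed[OF that] C.mem_carrier[OF that] by (simp add: inv_units_E)
  have mult: "x * y \<in> circ_C n" if "x \<in> circ_C n" "y \<in> circ_C n" for x y
    using C.m_closed[OF that] by (simp add: units_E_simps)
  have one: "1 \<in> circ_C n" using C.one_closed by (simp add: units_E_simps)
  have power: "x ^ k \<in> circ_C n" if "x \<in> circ_C n" for x k
    by (induction k) (auto simp: one mult that)
  have unit: "conj_unit i \<in> circ_C n" for i
    using conjugates_in_circ_C(1)[of "\<sigma> [^]\<^bsub>gal_G n\<^esub> i" n] gal_G_pow[OF \<sigma>, of i]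
    by (simp add: conj_unit_def tower_add gen_X_in_tower Rats_subset_tower)
  have "(\<Prod>i\<in>I. conj_unit i powi a i) \<in> circ_C n" for I a
    by (induction I rule: infinite_finite_induct)
      (auto simp: one power_int_def intro!: mult power inverse unit)
  then show "x \<in> circ_C n" if "x \<in> range circ" for x
    using that by (auto simp: circ_def)
qed

lemma range_circ_stable: "x \<in> range circ \<Longrightarrow> \<sigma> x \<in> range circ"
proof -
  have power: "x ^ k \<in> range circ" if "x \<in> range circ" for x k
    using that by (auto simp: circ_mult[symmetric])
  have "(\<Prod>i\<in>I. conj_unit (i + 1) powi a i) \<in> range circ" for I and a :: "nat \<Rightarrow> int"
  proof (induction I rule: infinite_finite_induct)
    case (insert i I)
    have "conj_unit (i + 1) \<in> range circ" using conj_unit_eq_circ by blast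
    then have "conj_unit (i + 1) powi a i \<in> range circ"
      by (auto simp: power_int_def intro!: power range_circ_inverse)
    then show ?case using insert by (simp add: range_circ_mult)
  qed (use circ_0 in \<open>auto intro: range_eqI[of _ _ "\<lambda>_. 0"]\<close>)
  moreover assume "x \<in> range circ"
  then obtain a where "x = circ a" by blast
  ultimately show ?thesis using funpow_circ[of 1 a] by (simp add: circ_def)
qed

end

theorem theorem4p2:
  fixes l n :: nat and \<sigma> :: "real \<Rightarrow> real"
  assumes "Factorial_Ring.prime l"
    and "n \<ge> 1"
    and "\<sigma> \<in> carrier (gal_G n)"
    and "generate (gal_G n) {\<sigma>} = carrier (gal_G n)"
  shows "[card (primary_part l (RE_mod_A \<sigma> n)) = 1] (mod 2 ^ n)"
proof -
  note \<sigma> = assms(3)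
  interpret E: comm_group "units_E n" by (rule comm_group_units_E)
  interpret tower_endo n \<sigma> using \<sigma> by (simp add: gal_G_iff)
  define R where "R = (units_E n)\<lparr>carrier := RE_plus \<sigma> n\<rparr>"
  define A where "A = circ_A \<sigma> n"
  have cR: "carrier R = RE_plus \<sigma> n" and mR: "monoid.mult R = (*)" and oR: "\<one>\<^bsub>R\<^esub> = 1"
    by (auto simp: R_def units_E_simps)
  have A_iff: "x \<in> A \<longleftrightarrow> x \<in> RE_plus \<sigma> n \<and> x \<in> circ_C n" for x
    by (simp add: A_def circ_A_def)
  have R: "comm_group R"
    using E.subgroup_imp_group[OF subgroup_RE_plus[OF \<sigma>]]
    by (intro group.group_comm_groupI) (auto simp: R_def units_E_simps)
  interpret R: comm_group R by (rule R)
  have "subgroup A (units_E n)"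
    unfolding A_def circ_A_def
    by (intro E.subgroups_Inter_pair subgroup_RE_plus \<sigma> subgroup_circ_C)
  then have A: "subgroup A R"
    unfolding R_def by (rule E.subgroup_incl[OF _ subgroup_RE_plus[OF \<sigma>]]) (auto simp: A_iff)
  have Mod: "RE_mod_A \<sigma> n = R Mod A" by (simp add: RE_mod_A_def R_def A_def)
  have pow: "x [^]\<^bsub>R\<^esub> k = x ^ k" for x and k :: nat
    by (induction k) (auto simp: oR mR mult.commute)
  have RE: "x \<in> tower n" "x \<noteq> 0" "algebraic_int x" "x * (\<sigma> ^^ 2 ^ (n - 1)) x = 1"
    if "x \<in> RE_plus \<sigma> n" for x
    using that RE_plus_iff[OF \<sigma>] by (auto simp: carrier_units_E)
  have inv: "inv\<^bsub>R\<^esub> x = inverse x" if "x \<in> RE_plus \<sigma> n" for x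
    using that RE_plus_iff[OF \<sigma>] E.m_inv_consistent[OF subgroup_RE_plus[OF \<sigma>] that]
    by (simp add: R_def inv_units_E)
  show ?thesis
  proof (cases "(\<sigma> ^^ 2 ^ (n - 1)) (gen_X n) = gen_X n")
    case True
    interpret s: tower_endo n "\<sigma> ^^ 2 ^ (n - 1)" by (rule funpow)
    obtain m where m: "n = Suc m" using assms(2) by (cases n) auto
    \<comment> \<open>Here the iterate fixes all of \<open>tower n\<close>, and the norm condition
      becomes \<open>x * x = 1\<close>.\<close>
    have "x \<in> A" if x: "x \<in> RE_plus \<sigma> n" for x
    proof -
      obtain a b where ab: "a \<in> tower m" "b \<in> tower m" "x = a + b * gen_X n"
        using RE(1)[OF x] unfolding m by (rule tower_SucE)
      have abn: "a \<in> tower n" "b \<in> tower n" using ab by (auto simp: m intro: tower_Suc_mono)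
      have "(\<sigma> ^^ 2 ^ (n - 1)) a = a" "(\<sigma> ^^ 2 ^ (n - 1)) b = b"
        using funpow_fixes_tower[of m] ab by (auto simp: m)
      then have "(\<sigma> ^^ 2 ^ (n - 1)) x = x"
        using abn True by (simp only: ab(3) s.add s.mult tower_mult gen_X_in_tower)
      then have "x * x = 1" using RE(4)[OF x] by simp
      then have "x = 1 \<or> x = - 1" by (metis square_eq_1_iff)
      then show ?thesis
        using x conjugates_in_circ_C(2)[OF \<sigma>] subgroup.one_closed[OF subgroup_circ_C[of n]]
        by (auto simp: A_iff units_E_simps)
    qed
    then have "card (primary_part l (R Mod A)) = 1"
      by (intro card_primary_part_eq_1 R A assms(1)) (simp add: cR)
    then show ?thesis by (simp add: Mod)
  next
    case False
    interpret tower_flip n \<sigma>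
    proof
      fix j assume j: "j < n"
      obtain m where m: "n = Suc m" using assms(2) by (cases n) auto
      have "(\<sigma> ^^ 2 ^ j) (gen_X (Suc j)) \<noteq> gen_X (Suc j)"
        using gen_X_fixed_upwards[of j m] j False by (auto simp: m)
      then show "(\<sigma> ^^ 2 ^ j) (gen_X (Suc j)) = - gen_X (Suc j)"
        using tower_endo.gen_X_cases[OF funpow j funpow_fixes_gen_X] j by fastforce
    qed
    have C: "circ_C n = range circ" using circ_C_eq assms by blast
    show ?thesis
    proof (cases "l = 2")
      case True
      \<comment> \<open>Square roots are extracted one at a time, each staying circular.\<close>
      have "x \<in> range circ" if x: "x \<in> RE_plus \<sigma> n" "x ^ (2 ^ k) \<in> range circ" for x k
        using x(2)
      proof (induction k)
        case (Suc k)
        obtain a where "(x ^ (2 ^ k))\<^sup>2 = circ a"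
          using Suc.prems by (auto simp: power_mult[symmetric] mult.commute)
        then have "x ^ (2 ^ k) \<in> range circ"
          using RE(1,2)[OF x(1)] assms(2) by (intro sqrt_of_circ) (auto intro: tower_power)
        then show ?case by (rule Suc.IH)
      qed simp
      then have "card (primary_part l (R Mod A)) = 1"
        by (intro card_primary_part_eq_1 R A assms(1)) (auto simp: cR pow A_iff C True)
      then show ?thesis by (simp add: Mod)
    next
      case False
      define W where "W = {x \<in> tower n. algebraic_int x \<and> (\<forall>i. \<bar>(\<sigma> ^^ i) x\<bar> \<le> 3 ^ (2 ^ n))}"
      \<comment> \<open>A bounded representative \<open>x * circ b\<close> may leave
        \<open>RE_n^+\<close>, since \<open>circ b\<close> is only known to be circular.
        \<open>\<psi>\<close> recovers the class: the elements of \<open>RE_n^+\<close> differing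
        from \<open>w\<close> by a circular unit form one coset of \<open>A\<close>.\<close>
      define \<psi> where "\<psi> = (\<lambda>w. {y \<in> RE_plus \<sigma> n. \<exists>c\<in>circ_C n. w = y * c})"
      have "A #>\<^bsub>R\<^esub> x \<in> \<psi> ` W" if x: "x \<in> RE_plus \<sigma> n" "x ^ (l ^ k) \<in> A" for x k
      proof -
        obtain a where "x ^ (l ^ k) = circ a" using x(2) by (auto simp: A_iff C)
        then obtain b where b: "\<And>j. \<bar>(\<sigma> ^^ j) (x * circ b)\<bar> \<le> 3 ^ (2 ^ n)"
          using root_of_circ_bounded[of x "l ^ k" a] RE(1)[OF x(1)] assms(1)
          by (metis prime_gt_0_nat zero_less_power)
        define w where "w = x * circ b"
        have cb: "circ b \<in> circ_C n" by (simp add: C)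
        have "circ b \<in> carrier (units_E n)"
          using cb subgroup.mem_carrier[OF subgroup_circ_C] by blast
        then have "w \<in> W"
          using b RE[OF x(1)]
          by (auto simp: W_def w_def carrier_units_E tower_mult algebraic_int_times)
        moreover have "A #>\<^bsub>R\<^esub> x = \<psi> w"
        proof (intro equalityI subsetI)
          fix y assume "y \<in> A #>\<^bsub>R\<^esub> x"
          then obtain a where a: "a \<in> A" "y = a * x" by (auto simp: r_coset_def mR)
          have "a \<noteq> 0" using a(1) RE(2) by (auto simp: A_iff)
          then have "w = y * (inverse a * circ b)" by (simp add: w_def a(2))
          moreover have "inverse a * circ b \<in> circ_C n"
            using a(1) unfolding A_iff C by (intro range_circ_mult range_circ_inverse) auto
          moreover have "y \<in> RE_plus \<sigma> n"
            using R.m_closed[of a x] a x(1) by (simp add: cR mR A_iff)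
          ultimately show "y \<in> \<psi> w" by (auto simp: \<psi>_def)
        next
          fix y assume "y \<in> \<psi> w"
          then obtain c where c: "y \<in> RE_plus \<sigma> n" "c \<in> circ_C n" "x * circ b = y * c"
            by (auto simp: \<psi>_def w_def)
          have nz: "x \<noteq> 0" "c \<noteq> 0" using RE(2)[OF x(1)] c(2) by (auto simp: C circ_neq_0)
          have "y * inverse x = circ b * inverse c"
            using c(3) nz by (simp add: field_simps)
          also have "\<dots> \<in> circ_C n"
            using c(2) unfolding C by (intro range_circ_mult range_circ_inverse) auto
          finally have "y * inverse x \<in> circ_C n" .
          moreover have "y * inverse x \<in> RE_plus \<sigma> n"
            using R.m_closed[of y "inv\<^bsub>R\<^esub> x"] R.inv_closed[of x] c(1) x(1)
            by (simp add: cR mR inv)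
          ultimately have "y * inverse x \<in> A" by (simp add: A_iff)
          moreover have "y = (y * inverse x) * x" using nz by simp
          ultimately show "y \<in> A #>\<^bsub>R\<^esub> x" unfolding r_coset_def mR by blast
        qed
        ultimately show ?thesis by blast
      qed
      then have "primary_part l (R Mod A) \<subseteq> \<psi> ` W"
        by (auto simp: primary_part_FactGroup[OF R A assms(1)] cR pow)
      moreover have "finite W" unfolding W_def by (rule finite_bounded_conjugates) simp
      ultimately have fin: "finite (primary_part l (R Mod A))"
        by (meson finite_surj)
      have REs: "\<sigma> x \<in> RE_plus \<sigma> n" if x: "x \<in> RE_plus \<sigma> n" for x
      proof -
        interpret s: tower_endo n "\<sigma> ^^ 2 ^ (n - 1)" by (rule funpow)
        \<comment> \<open>\<open>\<sigma>\<close> commutes with its iterates, so it carries the norm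
          equation of \<open>x\<close> to that of \<open>\<sigma> x\<close>.\<close>
        have "\<sigma> x * (\<sigma> ^^ 2 ^ (n - 1)) (\<sigma> x) = \<sigma> (x * (\<sigma> ^^ 2 ^ (n - 1)) x)"
          using RE(1)[OF x] by (simp add: mult s.closed funpow_swap1 del: One_nat_def)
        also have "\<dots> = 1" using RE(4)[OF x] by (simp add: rat)
        finally show ?thesis using x by (simp add: RE_plus_iff[OF \<sigma>] unit)
      qed
      have "[card (primary_part l (R Mod A)) = 1] (mod 2 ^ n)"
      proof (rule card_primary_part_cong_1[OF R A assms(1) False assms(2) _ _ _ fin])
        show "\<sigma> \<in> hom R R" using REs RE(1) by (auto simp: hom_def cR mR mult)
        show "\<sigma> a \<in> A" if "a \<in> A" for a
          using that REs range_circ_stable by (auto simp: A_iff C)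
        show "(\<sigma> ^^ 2 ^ (n - 1)) x = inv\<^bsub>R\<^esub> x" if "x \<in> carrier R" for x
          using that RE(4)[of x] inv[of x] unfolding cR by (metis inverse_unique)
      qed
      then show ?thesis by (simp add: Mod)
    qed
  qed
qed

end
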